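(* Let $(x,u)$ be an optimal solution of the two-mode optimal control problem with time-invariant switching interface $g(x)=0$ described in the context, crossing the interface exactly once, at time $\tau\in(t_0,t_f)$, and let $\lambda_1,\lambda_2$ be the associated co-states before and after the switch. Put $m=\frac{\partial g}{\partial x}(x(\tau))\in\mathbb{R}^n$ (column vector) and, with all quantities evaluated at the switching time along the optimal solution, $$\Delta\lambda=\lambda_2(\tau)-\lambda_1(\tau),\quad \langle\lambda\rangle=\tfrac12(\lambda_2(\tau)+\lambda_1(\tau)),\quad \Delta f=f_2(\tau)-f_1(\tau),\quad \langle f\rangle=\tfrac12(f_2(\tau)+f_1(\tau)),\quad \Delta L=L_2(\tau)-L_1(\tau),$$ where $f_i(\tau)=f_i(x(\tau),u_i(\tau),\tau)$ and $L_i(\tau)=L_i(x(\tau),u_i(\tau),\tau)$. Then, provided $m^\top\langle f\rangle\neq 0$, the co-state satisfies the jump law $$\Delta\lambda=-\frac{\left(\Delta L+\langle\lambda\rangle^\top\Delta f\right)m}{m^\top\langle f\rangle}.$$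
   Context: Problem. The state is $x(t)\in\mathbb{R}^n$ and the control is $u(t)\in\mathbb{R}^m$ (this dimension $m$ is unrelated to the vector $m$ in the claim). The dynamics are $\dot x=f_1(x,u,t)$ if $g(x)\le 0$ and $\dot x=f_2(x,u,t)$ if $g(x)\ge 0$, where $g:\mathbb{R}^n\to\mathbb{R}$. The boundary conditions are $x(t_0)=x_0$ with $g(x_0)<0$ and $x(t_f)=x_f$ with $g(x_f)>0$, with $t_0<t_f$ fixed. The cost to be minimized is $J=\phi(x(t_f))+\int_{t_0}^{t_f}L(x,u,t)\,dt$, where $L=L_1(x,u,t)$ if $g(x)\le 0$ and $L=L_2(x,u,t)$ if $g(x)\ge 0$. The functions $f_i$, $L_i$, $\phi$, $g$ are continuously differentiable on their whole domains. The state is continuous at the interface (no state jumps), and the trajectory crosses the interface exactly once, at an unspecified time $\tau$, so $g(x(\tau))=0$. Notation. $x_1,u_1$ denote the restrictions of the solution to $[t_0,\tau]$ and $x_2,u_2$ those to $[\tau,t_f]$; $u_i$ is continuous up to $\tau$ (one-sided limits are used as values at $\tau$), $x_i$ is $C^1$, and $x_1(\tau)=x_2(\tau)=x(\tau)$. The mode Hamiltonians are $H_i(x,\lambda,u,t)=L_i(x,u,t)+\lambda^\top f_i(x,u,t)$. Associated co-states. These are $C^1$ functions $\lambda_1:[t_0,\tau]\to\mathbb{R}^n$ and $\lambda_2:[\tau,t_f]\to\mathbb{R}^n$ such that, together with a scalar Lagrange multiplier $\nu$, the augmented cost $$J_a=\phi(x_2(t_f))+\nu\, g(x(\tau))+\int_{t_0}^{\tau}\left[H_1(x_1,\lambda_1,u_1,t)-\lambda_1^\top\dot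 x_1\right]dt+\int_{\tau}^{t_f}\left[H_2(x_2,\lambda_2,u_2,t)-\lambda_2^\top\dot x_2\right]dt$$ is stationary at the optimal solution with respect to variations of $x_1,x_2,u_1,u_2,\tau$. That is, for $C^1$ one-parameter families $(x_1^\varepsilon,x_2^\varepsilon,u_1^\varepsilon,u_2^\varepsilon,\tau^\varepsilon)$ through the optimal solution at $\varepsilon=0$, with $x_1^\varepsilon(t_0)=x_0$, $x_2^\varepsilon(t_f)=x_f$, and $x_1^\varepsilon(\tau^\varepsilon)=x_2^\varepsilon(\tau^\varepsilon)$, the derivative of $J_a$ at $\varepsilon=0$ is zero. Here $x_i,u_i,\lambda_i$ are extended slightly past $\tau$, with $x_i$ and $\lambda_i$ extended as $C^1$ functions and $u_i$ as continuous functions, so that varying $\tau$ makes sense; the families are not required to satisfy the state equations. *)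

theory Defs
  imports "HOL-Analysis.Analysis"
begin

(* At boundary points of S the derivative is taken within S, i.e. it is one-sided on an interval. *)
definition C1_on :: "('a::real_normed_vector \<Rightarrow> 'b::real_normed_vector) \<Rightarrow> 'a set \<Rightarrow> bool" where
  "C1_on f S \<longleftrightarrow>
     (\<exists>f'. (\<forall>x\<in>S. (f has_derivative blinfun_apply (f' x)) (at x within S)) \<and> continuous_on S f')"


section \<open>The two-mode optimal control problem\<close>

(* u1 and u2 are the restrictions of the control u to the two phases, completed at the
   switching time \<tau> by the one-sided limits of u; the value u \<tau> itself is irrelevant. *)
definition phase_controls ::
  "real \<Rightarrow> real \<Rightarrow> real \<Rightarrow> (real \<Rightarrow> real^'m) \<Rightarrow> (real \<Rightarrow> real^'m) \<Rightarrow> (real \<Rightarrow> real^'m) \<Rightarrow> bool" where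
  "phase_controls t0 tf \<tau> u u1 u2 \<longleftrightarrow>
     continuous_on {t0..\<tau>} u1 \<and> (\<forall>t\<in>{t0..<\<tau>}. u1 t = u t) \<and>
     continuous_on {\<tau>..tf} u2 \<and> (\<forall>t\<in>{\<tau><..tf}. u2 t = u t)"

(* The state equation is not imposed at t = \<tau>, where x may have a corner; since x is C1 on both
   closed phases, it holds there in the one-sided sense with the one-sided limits of u. *)
definition admissible ::
  "(real^'n \<Rightarrow> real^'m \<Rightarrow> real \<Rightarrow> real^'n) \<Rightarrow> (real^'n \<Rightarrow> real^'m \<Rightarrow> real \<Rightarrow> real^'n) \<Rightarrow>
   (real^'n \<Rightarrow> real) \<Rightarrow> real \<Rightarrow> real \<Rightarrow> real^'n \<Rightarrow> real^'n \<Rightarrow>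
   (real \<Rightarrow> real^'n) \<Rightarrow> (real \<Rightarrow> real^'m) \<Rightarrow> real \<Rightarrow> bool" where
  "admissible f1 f2 g t0 tf x0 xf x u \<tau> \<longleftrightarrow>
     t0 < \<tau> \<and> \<tau> < tf \<and>
     continuous_on {t0..tf} x \<and> C1_on x {t0..\<tau>} \<and> C1_on x {\<tau>..tf} \<and>
     (\<exists>u1 u2. phase_controls t0 tf \<tau> u u1 u2) \<and>
     x t0 = x0 \<and> x tf = xf \<and>
     (\<forall>t\<in>{t0..tf}. g (x t) = 0 \<longleftrightarrow> t = \<tau>) \<and>
     (\<forall>t\<in>{t0..tf} - {\<tau>}.
        (g (x t) \<le> 0 \<longrightarrow> (x has_vector_derivative f1 (x t) (u t) t) (at t within {t0..tf})) \<and>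
        (g (x t) \<ge> 0 \<longrightarrow> (x has_vector_derivative f2 (x t) (u t) t) (at t within {t0..tf})))"

(* L1 and L2 may disagree on g x = 0; an admissible trajectory is there at a single time only,
   so the choice made here does not affect the cost. *)
definition running_cost ::
  "(real^'n \<Rightarrow> real^'m \<Rightarrow> real \<Rightarrow> real) \<Rightarrow> (real^'n \<Rightarrow> real^'m \<Rightarrow> real \<Rightarrow> real) \<Rightarrow>
   (real^'n \<Rightarrow> real) \<Rightarrow> real^'n \<Rightarrow> real^'m \<Rightarrow> real \<Rightarrow> real" where
  "running_cost L1 L2 g x u t = (if g x \<le> 0 then L1 x u t else L2 x u t)"

definition cost ::
  "(real^'n \<Rightarrow> real^'m \<Rightarrow> real \<Rightarrow> real) \<Rightarrow> (real^'n \<Rightarrow> real^'m \<Rightarrow> real \<Rightarrow> real) \<Rightarrow>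
   (real^'n \<Rightarrow> real) \<Rightarrow> (real^'n \<Rightarrow> real) \<Rightarrow> real \<Rightarrow> real \<Rightarrow>
   (real \<Rightarrow> real^'n) \<Rightarrow> (real \<Rightarrow> real^'m) \<Rightarrow> real" where
  "cost L1 L2 \<phi> g t0 tf x u =
     \<phi> (x tf) + integral {t0..tf} (\<lambda>t. running_cost L1 L2 g (x t) (u t) t)"

definition optimal ::
  "(real^'n \<Rightarrow> real^'m \<Rightarrow> real \<Rightarrow> real^'n) \<Rightarrow> (real^'n \<Rightarrow> real^'m \<Rightarrow> real \<Rightarrow> real^'n) \<Rightarrow>
   (real^'n \<Rightarrow> real^'m \<Rightarrow> real \<Rightarrow> real) \<Rightarrow> (real^'n \<Rightarrow> real^'m \<Rightarrow> real \<Rightarrow> real) \<Rightarrow>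
   (real^'n \<Rightarrow> real) \<Rightarrow> (real^'n \<Rightarrow> real) \<Rightarrow> real \<Rightarrow> real \<Rightarrow> real^'n \<Rightarrow> real^'n \<Rightarrow>
   (real \<Rightarrow> real^'n) \<Rightarrow> (real \<Rightarrow> real^'m) \<Rightarrow> real \<Rightarrow> bool" where
  "optimal f1 f2 L1 L2 \<phi> g t0 tf x0 xf x u \<tau> \<longleftrightarrow>
     admissible f1 f2 g t0 tf x0 xf x u \<tau> \<and>
     (\<forall>y v \<sigma>. admissible f1 f2 g t0 tf x0 xf y v \<sigma> \<longrightarrow>
        cost L1 L2 \<phi> g t0 tf x u \<le> cost L1 L2 \<phi> g t0 tf y v)"


section \<open>Stationarity of the augmented cost and associated co-states\<close>

definition hamiltonian ::
  "(real^'n \<Rightarrow> real^'m \<Rightarrow> real \<Rightarrow> real) \<Rightarrow> (real^'n \<Rightarrow> real^'m \<Rightarrow> real \<Rightarrow> real^'n) \<Rightarrow>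
   real^'n \<Rightarrow> real^'n \<Rightarrow> real^'m \<Rightarrow> real \<Rightarrow> real" where
  "hamiltonian L f x l u t = L x u t + l \<bullet> f x u t"

definition augmented_cost ::
  "(real^'n \<Rightarrow> real^'m \<Rightarrow> real \<Rightarrow> real^'n) \<Rightarrow> (real^'n \<Rightarrow> real^'m \<Rightarrow> real \<Rightarrow> real^'n) \<Rightarrow>
   (real^'n \<Rightarrow> real^'m \<Rightarrow> real \<Rightarrow> real) \<Rightarrow> (real^'n \<Rightarrow> real^'m \<Rightarrow> real \<Rightarrow> real) \<Rightarrow>
   (real^'n \<Rightarrow> real) \<Rightarrow> (real^'n \<Rightarrow> real) \<Rightarrow> real \<Rightarrow> real \<Rightarrow>
   (real \<Rightarrow> real^'n) \<Rightarrow> (real \<Rightarrow> real^'n) \<Rightarrow> real \<Rightarrow>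
   (real \<Rightarrow> real^'n) \<Rightarrow> (real \<Rightarrow> real^'n) \<Rightarrow> (real \<Rightarrow> real^'m) \<Rightarrow> (real \<Rightarrow> real^'m) \<Rightarrow> real \<Rightarrow> real" where
  "augmented_cost f1 f2 L1 L2 \<phi> g t0 tf p1 p2 \<nu> x1 x2 u1 u2 \<tau> =
     \<phi> (x2 tf) + \<nu> * g (x1 \<tau>)
     + integral {t0..\<tau>} (\<lambda>t. hamiltonian L1 f1 (x1 t) (p1 t) (u1 t) t
                            - p1 t \<bullet> vector_derivative x1 (at t within {t0..\<tau>}))
     + integral {\<tau>..tf} (\<lambda>t. hamiltonian L2 f2 (x2 t) (p2 t) (u2 t) t
                            - p2 t \<bullet> vector_derivative x2 (at t within {\<tau>..tf}))"

(* For open I and compact S: \<epsilon> \<mapsto> X \<epsilon> is a C1 curve in the Banach space C(S). *)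
definition C1_family_C0 ::
  "real set \<Rightarrow> real set \<Rightarrow> (real \<Rightarrow> real \<Rightarrow> 'a::real_normed_vector) \<Rightarrow> bool" where
  "C1_family_C0 I S X \<longleftrightarrow>
     continuous_on (I \<times> S) (\<lambda>(\<epsilon>, t). X \<epsilon> t) \<and>
     (\<exists>D. (\<forall>\<epsilon>\<in>I. \<forall>t\<in>S. ((\<lambda>e. X e t) has_vector_derivative D \<epsilon> t) (at \<epsilon>)) \<and>
          continuous_on (I \<times> S) (\<lambda>(\<epsilon>, t). D \<epsilon> t))"

(* For open I and a compact interval S: \<epsilon> \<mapsto> X \<epsilon> is a C1 curve in the Banach space C1(S). *)
definition C1_family_C1 ::
  "real set \<Rightarrow> real set \<Rightarrow> (real \<Rightarrow> real \<Rightarrow> 'a::real_normed_vector) \<Rightarrow> bool" where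
  "C1_family_C1 I S X \<longleftrightarrow>
     C1_family_C0 I S X \<and>
     (\<exists>X'. (\<forall>\<epsilon>\<in>I. \<forall>t\<in>S. (X \<epsilon> has_vector_derivative X' \<epsilon> t) (at t within S)) \<and>
           C1_family_C0 I S X')"

(* x1, u1 live on {t0..\<tau>+\<eta>} and x2, u2 on {\<tau>-\<eta>..tf}; \<eta> is the margin by which all
   functions are extended past \<tau>. *)
definition variation ::
  "real \<Rightarrow> real \<Rightarrow> real^'n \<Rightarrow> real^'n \<Rightarrow> real \<Rightarrow>
   (real \<Rightarrow> real^'n) \<Rightarrow> (real \<Rightarrow> real^'n) \<Rightarrow> (real \<Rightarrow> real^'m) \<Rightarrow> (real \<Rightarrow> real^'m) \<Rightarrow> real \<Rightarrow> real \<Rightarrow>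
   (real \<Rightarrow> real \<Rightarrow> real^'n) \<Rightarrow> (real \<Rightarrow> real \<Rightarrow> real^'n) \<Rightarrow>
   (real \<Rightarrow> real \<Rightarrow> real^'m) \<Rightarrow> (real \<Rightarrow> real \<Rightarrow> real^'m) \<Rightarrow> (real \<Rightarrow> real) \<Rightarrow> bool" where
  "variation t0 tf x0 xf \<eta> x1 x2 u1 u2 \<tau> \<delta> X1 X2 U1 U2 T \<longleftrightarrow>
     C1_family_C1 {-\<delta><..<\<delta>} {t0..\<tau> + \<eta>} X1 \<and> C1_family_C1 {-\<delta><..<\<delta>} {\<tau> - \<eta>..tf} X2 \<and>
     C1_family_C0 {-\<delta><..<\<delta>} {t0..\<tau> + \<eta>} U1 \<and> C1_family_C0 {-\<delta><..<\<delta>} {\<tau> - \<eta>..tf} U2 \<and>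
     C1_on T {-\<delta><..<\<delta>} \<and>
     (\<forall>t\<in>{t0..\<tau> + \<eta>}. X1 0 t = x1 t \<and> U1 0 t = u1 t) \<and>
     (\<forall>t\<in>{\<tau> - \<eta>..tf}. X2 0 t = x2 t \<and> U2 0 t = u2 t) \<and>
     T 0 = \<tau> \<and>
     (\<forall>\<epsilon>\<in>{-\<delta><..<\<delta>}. T \<epsilon> \<in> {\<tau> - \<eta>..\<tau> + \<eta>} \<and>
        X1 \<epsilon> t0 = x0 \<and> X2 \<epsilon> tf = xf \<and> X1 \<epsilon> (T \<epsilon>) = X2 \<epsilon> (T \<epsilon>))"

(* x1, x2, u1, u2, l1, l2 are the extensions past \<tau> of x, the phase controls v1, v2 and the
   co-states p1, p2. The derivative of the augmented cost at \<epsilon> = 0 does not depend on which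
   extensions are chosen. *)
definition associated_costates ::
  "(real^'n \<Rightarrow> real^'m \<Rightarrow> real \<Rightarrow> real^'n) \<Rightarrow> (real^'n \<Rightarrow> real^'m \<Rightarrow> real \<Rightarrow> real^'n) \<Rightarrow>
   (real^'n \<Rightarrow> real^'m \<Rightarrow> real \<Rightarrow> real) \<Rightarrow> (real^'n \<Rightarrow> real^'m \<Rightarrow> real \<Rightarrow> real) \<Rightarrow>
   (real^'n \<Rightarrow> real) \<Rightarrow> (real^'n \<Rightarrow> real) \<Rightarrow> real \<Rightarrow> real \<Rightarrow> real^'n \<Rightarrow> real^'n \<Rightarrow>
   (real \<Rightarrow> real^'n) \<Rightarrow> (real \<Rightarrow> real^'m) \<Rightarrow> (real \<Rightarrow> real^'m) \<Rightarrow> real \<Rightarrow>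
   (real \<Rightarrow> real^'n) \<Rightarrow> (real \<Rightarrow> real^'n) \<Rightarrow> bool" where
  "associated_costates f1 f2 L1 L2 \<phi> g t0 tf x0 xf x v1 v2 \<tau> p1 p2 \<longleftrightarrow>
     C1_on p1 {t0..\<tau>} \<and> C1_on p2 {\<tau>..tf} \<and>
     (\<exists>\<eta>>0. \<exists>x1 x2 u1 u2 l1 l2 \<nu>.
        C1_on x1 {t0..\<tau> + \<eta>} \<and> C1_on x2 {\<tau> - \<eta>..tf} \<and>
        continuous_on {t0..\<tau> + \<eta>} u1 \<and> continuous_on {\<tau> - \<eta>..tf} u2 \<and>
        C1_on l1 {t0..\<tau> + \<eta>} \<and> C1_on l2 {\<tau> - \<eta>..tf} \<and>
        (\<forall>t\<in>{t0..\<tau>}. x1 t = x t \<and> u1 t = v1 t \<and> l1 t = p1 t) \<and>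
        (\<forall>t\<in>{\<tau>..tf}. x2 t = x t \<and> u2 t = v2 t \<and> l2 t = p2 t) \<and>
        (\<forall>\<delta>>0. \<forall>X1 X2 U1 U2 T.
           variation t0 tf x0 xf \<eta> x1 x2 u1 u2 \<tau> \<delta> X1 X2 U1 U2 T \<longrightarrow>
           ((\<lambda>\<epsilon>. augmented_cost f1 f2 L1 L2 \<phi> g t0 tf l1 l2 \<nu> (X1 \<epsilon>) (X2 \<epsilon>) (U1 \<epsilon>) (U2 \<epsilon>) (T \<epsilon>))
              has_real_derivative 0) (at 0)))"

end

theory Submission
  imports Defs
begin

text \<open>
  The jump law follows from the two corner conditions at the switching time,
  \<open>\<Delta>\<lambda> = - \<nu> m\<close> and \<open>H\<^sub>1 = H\<^sub>2\<close>. Indeed, the second one says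
  \<open>\<Delta>L + \<lambda>\<^sub>2 \<bullet> f\<^sub>2 - \<lambda>\<^sub>1 \<bullet> f\<^sub>1 = 0\<close>. By the discrete product rule
  \<open>\<lambda>\<^sub>2 \<bullet> f\<^sub>2 - \<lambda>\<^sub>1 \<bullet> f\<^sub>1 = \<langle>\<lambda>\<rangle> \<bullet> \<Delta>f + \<Delta>\<lambda> \<bullet> \<langle>f\<rangle>\<close> it becomes
  \<open>\<Delta>L + \<langle>\<lambda>\<rangle> \<bullet> \<Delta>f = \<nu> (m \<bullet> \<langle>f\<rangle>)\<close>, which determines \<open>\<nu>\<close>.

  The corner conditions come from testing stationarity with families that cross at time
  \<open>\<tau> + s \<epsilon>\<close> in the point \<open>x \<tau> + \<epsilon> v\<close> (\<open>steered\<close>). In each phase the integral of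
  \<open>- \<lambda> \<bullet> X'\<close> is integrated by parts, so that the derivative of the augmented cost is
  \<open>(\<nu> m + \<Delta>\<lambda>) \<bullet> v + (H\<^sub>1 - H\<^sub>2) s\<close> plus one integral over each phase
  (\<open>phase_cost_derivative\<close>). These integrals are negligible when the
  perturbation of each trajectory is concentrated near the switching time
  (\<open>concentrated_profile\<close>), while the terms at the switching time
  stay the same (\<open>phase_variation\<close>). Therefore
  \<open>(\<nu> m + \<Delta>\<lambda>) \<bullet> v + (H\<^sub>1 - H\<^sub>2) s = 0\<close> for all \<open>v\<close> and \<open>s\<close>
  (\<open>associated_costates_stationarity\<close>), and \<open>s = 0\<close> and \<open>v = 0\<close> give the two corner conditions.
\<close>

section \<open>Integrals with a moving endpoint\<close>

lemma continuous_on_slice: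
  assumes "continuous_on (I \<times> S) (\<lambda>(\<epsilon>, t). G \<epsilon> t)" "\<epsilon> \<in> I"
  shows "continuous_on S (G \<epsilon>)"
proof -
  have "continuous_on S (\<lambda>t. case (\<epsilon>, t) of (\<epsilon>, t) \<Rightarrow> G \<epsilon> t)"
    by (rule continuous_on_compose2[OF assms(1)])
      (use assms(2) in \<open>auto intro: continuous_on_Pair continuous_on_const continuous_on_id\<close>)
  then show ?thesis by simp
qed

text \<open>As a function of the parameter and of the endpoint separately, the integral has the partial
  derivatives \<open>integral {a..\<tau>} (D 0)\<close> (differentiation under the integral sign) and \<open>G\<close>
  (fundamental theorem of calculus). The second one is jointly continuous, which makes the
  integral totally differentiable at \<open>(0, \<tau>)\<close>, so the chain rule along
  \<open>\<epsilon> \<mapsto> (\<epsilon>, T \<epsilon>)\<close> applies.\<close>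

lemma leibniz_moving_upper:
  fixes G D :: "real \<Rightarrow> real \<Rightarrow> real"
  assumes "\<delta> > 0" and ab: "a < \<tau>" "\<tau> < b"
    and der: "\<And>\<epsilon> t. \<epsilon> \<in> {-\<delta><..<\<delta>} \<Longrightarrow> t \<in> {a..b} \<Longrightarrow> ((\<lambda>e. G e t) has_real_derivative D \<epsilon> t) (at \<epsilon>)"
    and contG: "continuous_on ({-\<delta><..<\<delta>} \<times> {a..b}) (\<lambda>(\<epsilon>, t). G \<epsilon> t)"
    and contD: "continuous_on ({-\<delta><..<\<delta>} \<times> {a..b}) (\<lambda>(\<epsilon>, t). D \<epsilon> t)"
    and T: "(T has_real_derivative s) (at 0)" "T 0 = \<tau>"
  shows "((\<lambda>\<epsilon>. integral {a..T \<epsilon>} (G \<epsilon>)) has_real_derivative (integral {a..\<tau>} (D 0) + G 0 \<tau> * s)) (at 0)"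
proof -
  define I where "I = {-\<delta><..<\<delta>}"
  have I: "0 \<in> I" "open I" "convex I" using \<open>\<delta> > 0\<close> by (auto simp: I_def)
  have G\<epsilon>: "continuous_on {a..b} (G \<epsilon>)" if "\<epsilon> \<in> I" for \<epsilon>
    using continuous_on_slice[OF contG] that by (simp add: I_def)
  let ?P = "\<lambda>\<epsilon> r. integral {a..r} (G \<epsilon>)"
  have "((\<lambda>\<epsilon>. integral (cbox a \<tau>) (G \<epsilon>)) has_real_derivative integral (cbox a \<tau>) (D 0)) (at 0 within I)"
  proof (rule leibniz_rule_field_derivative)
    show "((\<lambda>x. G x t) has_real_derivative D x t) (at x within I)" if "x \<in> I" "t \<in> cbox a \<tau>" for x t
      using der[of x t] that ab by (auto simp: I_def intro: has_field_derivative_at_within)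
    show "G x integrable_on cbox a \<tau>" if "x \<in> I" for x
      using ab by (auto intro!: integrable_continuous_interval continuous_on_subset[OF G\<epsilon>[OF that]])
    show "continuous_on (I \<times> cbox a \<tau>) (\<lambda>(x, t). D x t)"
      using ab by (intro continuous_on_subset[OF contD]) (auto simp: I_def)
  qed (use I in auto)
  then have "((\<lambda>\<epsilon>. ?P \<epsilon> \<tau>) has_derivative (*) (integral {a..\<tau>} (D 0))) (at 0 within I)"
    by (simp add: has_field_derivative_def)
  moreover have "((\<lambda>r. ?P \<epsilon> r) has_derivative blinfun_apply (blinfun_mult_right (G \<epsilon> r)))
      (at r within {a<..<b})" if "\<epsilon> \<in> I" "r \<in> {a<..<b}" for \<epsilon> r
  proof -
    have "((\<lambda>r. ?P \<epsilon> r) has_real_derivative G \<epsilon> r) (at r within {a..b})"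
      using G\<epsilon> that by (intro integral_has_real_derivative) auto
    then have "((\<lambda>r. ?P \<epsilon> r) has_real_derivative G \<epsilon> r) (at r within {a<..<b})"
      by (rule DERIV_subset) auto
    then show ?thesis by (simp add: has_field_derivative_def)
  qed
  moreover have "continuous (at (0, \<tau>) within I \<times> {a<..<b}) (\<lambda>(\<epsilon>, r). blinfun_mult_right (G \<epsilon> r))"
  proof -
    have "continuous_on (I \<times> {a<..<b}) (\<lambda>p. blinfun_mult_right (case p of (\<epsilon>, r) \<Rightarrow> G \<epsilon> r))"
      by (intro bounded_linear.continuous_on[OF bounded_linear_blinfun_mult_right]
          continuous_on_subset[OF contG]) (auto simp: I_def)
    then show ?thesis
      using I ab by (auto simp: continuous_on_eq_continuous_within case_prod_unfold)
  qed
  ultimately have "((\<lambda>(\<epsilon>, r). ?P \<epsilon> r) has_derivative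
       (\<lambda>(te, tr). integral {a..\<tau>} (D 0) * te + blinfun_mult_right (G 0 \<tau>) tr)) (at (0, \<tau>) within I \<times> {a<..<b})"
    using ab by (intro has_derivative_partialsI) auto
  then have "((\<lambda>(\<epsilon>, r). ?P \<epsilon> r) has_derivative
       (\<lambda>(te, tr). integral {a..\<tau>} (D 0) * te + G 0 \<tau> * tr)) (at (0, \<tau>))"
    using I ab by (subst (asm) at_within_open) (auto intro: open_Times)
  moreover have "((\<lambda>\<epsilon>. (\<epsilon>, T \<epsilon>)) has_derivative (\<lambda>h. (h, s * h))) (at 0)"
    using T by (intro has_derivative_Pair) (auto simp: has_field_derivative_def intro: has_derivative_ident)
  ultimately have "((\<lambda>\<epsilon>. case (\<epsilon>, T \<epsilon>) of (\<epsilon>, r) \<Rightarrow> ?P \<epsilon> r) has_derivative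
       (\<lambda>h. case (h, s * h) of (te, tr) \<Rightarrow> integral {a..\<tau>} (D 0) * te + G 0 \<tau> * tr)) (at 0)"
    using has_derivative_compose[of "\<lambda>\<epsilon>. (\<epsilon>, T \<epsilon>)"] T(2) by force
  then have "((\<lambda>\<epsilon>. ?P \<epsilon> (T \<epsilon>)) has_derivative (\<lambda>h. integral {a..\<tau>} (D 0) * h + G 0 \<tau> * (s * h))) (at 0)"
    by simp
  then show ?thesis
    unfolding has_field_derivative_def
    by (rule has_derivative_eq_rhs) (auto simp: algebra_simps)
qed

text \<open>Reduced to a moving upper endpoint by subtraction from the integral over all of \<open>{a..b}\<close>.
  This is why \<open>G\<close> is considered on both sides of \<open>\<tau>\<close>.\<close>

lemma leibniz_moving_lower:
  fixes G D :: "real \<Rightarrow> real \<Rightarrow> real"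
  assumes \<delta>: "\<delta> > 0" and ab: "a < \<tau>" "\<tau> < b"
    and der: "\<And>\<epsilon> t. \<epsilon> \<in> {-\<delta><..<\<delta>} \<Longrightarrow> t \<in> {a..b} \<Longrightarrow> ((\<lambda>e. G e t) has_real_derivative D \<epsilon> t) (at \<epsilon>)"
    and contG: "continuous_on ({-\<delta><..<\<delta>} \<times> {a..b}) (\<lambda>(\<epsilon>, t). G \<epsilon> t)"
    and contD: "continuous_on ({-\<delta><..<\<delta>} \<times> {a..b}) (\<lambda>(\<epsilon>, t). D \<epsilon> t)"
    and T: "(T has_real_derivative s) (at 0)" "T 0 = \<tau>"
  shows "((\<lambda>\<epsilon>. integral {T \<epsilon>..b} (G \<epsilon>)) has_real_derivative (integral {\<tau>..b} (D 0) - G 0 \<tau> * s)) (at 0)"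
proof -
  define I where "I = {-\<delta><..<\<delta>}"
  have I: "0 \<in> I" "open I" "convex I" using \<open>\<delta> > 0\<close> by (auto simp: I_def)
  have G\<epsilon>: "continuous_on {a..b} (G \<epsilon>)" if "\<epsilon> \<in> I" for \<epsilon>
    using continuous_on_slice[OF contG] that by (simp add: I_def)
  have D0: "continuous_on {a..b} (D 0)"
    using continuous_on_slice[OF contD] \<delta> by simp
  have "((\<lambda>\<epsilon>. integral (cbox a b) (G \<epsilon>)) has_real_derivative integral (cbox a b) (D 0)) (at 0 within I)"
  proof (rule leibniz_rule_field_derivative)
    show "((\<lambda>x. G x t) has_real_derivative D x t) (at x within I)" if "x \<in> I" "t \<in> cbox a b" for x t
      using der[of x t] that by (auto simp: I_def intro: has_field_derivative_at_within)
    show "G x integrable_on cbox a b" if "x \<in> I" for x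
      using G\<epsilon>[OF that] by (auto intro!: integrable_continuous_interval)
    show "continuous_on (I \<times> cbox a b) (\<lambda>(x, t). D x t)"
      using contD by (simp add: I_def)
  qed (use I in auto)
  then have "((\<lambda>\<epsilon>. integral {a..b} (G \<epsilon>)) has_real_derivative integral {a..b} (D 0)) (at 0)"
    using I by (subst (asm) at_within_open) auto
  from DERIV_diff[OF this leibniz_moving_upper[OF assms]]
  have "((\<lambda>\<epsilon>. integral {a..b} (G \<epsilon>) - integral {a..T \<epsilon>} (G \<epsilon>)) has_real_derivative
          (integral {a..b} (D 0) - (integral {a..\<tau>} (D 0) + G 0 \<tau> * s))) (at 0)" .
  moreover have "integral {a..\<tau>} (D 0) + integral {\<tau>..b} (D 0) = integral {a..b} (D 0)"
    using ab D0 by (intro Henstock_Kurzweil_Integration.integral_combine integrable_continuous_interval) auto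
  moreover have "\<forall>\<^sub>F \<epsilon> in nhds 0. integral {a..b} (G \<epsilon>) - integral {a..T \<epsilon>} (G \<epsilon>) = integral {T \<epsilon>..b} (G \<epsilon>)"
  proof -
    have "(T \<longlongrightarrow> \<tau>) (nhds 0)"
      using DERIV_isCont[OF T(1)] T(2) tendsto_at_iff_tendsto_nhds[of T 0] by (simp add: isCont_def)
    then have "\<forall>\<^sub>F \<epsilon> in nhds 0. T \<epsilon> \<in> {a<..<b}"
      using ab by (intro topological_tendstoD) auto
    moreover have "\<forall>\<^sub>F \<epsilon> in nhds 0. \<epsilon> \<in> I"
      using I eventually_nhds_in_open by blast
    ultimately show ?thesis
    proof eventually_elim
      case (elim \<epsilon>)
      have "integral {a..T \<epsilon>} (G \<epsilon>) + integral {T \<epsilon>..b} (G \<epsilon>) = integral {a..b} (G \<epsilon>)"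
        using elim G\<epsilon> by (intro Henstock_Kurzweil_Integration.integral_combine integrable_continuous_interval) auto
      then show ?case by simp
    qed
  qed
  ultimately show ?thesis
    by (elim DERIV_cong_ev[OF refl _ _, THEN iffD1, rotated 2]) simp_all
qed

section \<open>Affine families of trajectories\<close>

lemma C1_on_real_obtain:
  fixes x :: "real \<Rightarrow> 'a::real_normed_vector"
  assumes "C1_on x S"
  obtains x' where "\<And>t. t \<in> S \<Longrightarrow> (x has_vector_derivative x' t) (at t within S)" "continuous_on S x'"
proof -
  from assms obtain f' where f': "\<And>t. t \<in> S \<Longrightarrow> (x has_derivative blinfun_apply (f' t)) (at t within S)"
    "continuous_on S f'" by (auto simp: C1_on_def)
  show ?thesis
  proof
    show "(x has_vector_derivative f' t 1) (at t within S)" if "t \<in> S" for t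
      using f'(1)[OF that] unfolding has_vector_derivative_def
      by (rule has_derivative_eq_rhs) (auto simp flip: blinfun.scaleR_right)
    show "continuous_on S (\<lambda>t. f' t 1)"
      using f'(2) by (intro continuous_intros)
  qed
qed

lemma C1_family_C0_affine:
  fixes x :: "real \<Rightarrow> 'a::real_normed_vector" and \<psi> :: "real \<Rightarrow> real"
  assumes "continuous_on S x" "continuous_on S \<psi>"
    and c: "\<And>\<epsilon>. \<epsilon> \<in> I \<Longrightarrow> (c has_vector_derivative c' \<epsilon>) (at \<epsilon>)" "continuous_on I c'"
  shows "C1_family_C0 I S (\<lambda>\<epsilon> t. x t + \<psi> t *\<^sub>R c \<epsilon>)"
proof -
  have "continuous_on I c"
    using c(1) has_vector_derivative_continuous continuous_at_imp_continuous_on by blast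
  note product_continuity =
    continuous_on_compose2[OF assms(1) continuous_on_snd[OF continuous_on_id]]
    continuous_on_compose2[OF assms(2) continuous_on_snd[OF continuous_on_id]]
    continuous_on_compose2[OF \<open>continuous_on I c\<close> continuous_on_fst[OF continuous_on_id]]
    continuous_on_compose2[OF c(2) continuous_on_fst[OF continuous_on_id]]
  show ?thesis
    unfolding C1_family_C0_def case_prod_unfold
  proof (intro conjI exI[of _ "\<lambda>\<epsilon> t. \<psi> t *\<^sub>R c' \<epsilon>"] ballI)
    show "continuous_on (I \<times> S) (\<lambda>p. x (snd p) + \<psi> (snd p) *\<^sub>R c (fst p))"
      by (intro continuous_on_add continuous_on_scaleR product_continuity) auto
    show "continuous_on (I \<times> S) (\<lambda>p. \<psi> (snd p) *\<^sub>R c' (fst p))"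
      by (intro continuous_on_scaleR product_continuity) auto
    show "((\<lambda>e. x t + \<psi> t *\<^sub>R c e) has_vector_derivative \<psi> t *\<^sub>R c' \<epsilon>) (at \<epsilon>)"
      if "\<epsilon> \<in> I" for \<epsilon> t
      using c(1)[OF that] by (auto intro!: derivative_eq_intros)
  qed
qed

lemma C1_family_C1_affine:
  fixes x :: "real \<Rightarrow> 'a::real_normed_vector" and \<psi> :: "real \<Rightarrow> real"
  assumes x: "\<And>t. t \<in> S \<Longrightarrow> (x has_vector_derivative x' t) (at t within S)" "continuous_on S x'"
    and \<psi>: "\<And>t. t \<in> S \<Longrightarrow> (\<psi> has_real_derivative \<psi>' t) (at t within S)" "continuous_on S \<psi>'"
    and c: "\<And>\<epsilon>. \<epsilon> \<in> I \<Longrightarrow> (c has_vector_derivative c' \<epsilon>) (at \<epsilon>)" "continuous_on I c'"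
  shows "C1_family_C1 I S (\<lambda>\<epsilon> t. x t + \<psi> t *\<^sub>R c \<epsilon>)"
proof -
  have "continuous_on S x" "continuous_on S \<psi>"
    using continuous_on_vector_derivative x(1) DERIV_continuous_on \<psi>(1) by blast+
  moreover have "((\<lambda>t. x t + \<psi> t *\<^sub>R c \<epsilon>) has_vector_derivative x' t + \<psi>' t *\<^sub>R c \<epsilon>) (at t within S)"
    if "t \<in> S" for \<epsilon> t
    using x(1)[OF that] \<psi>(1)[OF that]
    by (auto intro!: derivative_eq_intros)
  ultimately show ?thesis
    unfolding C1_family_C1_def using assms
    by (intro conjI exI[of _ "\<lambda>\<epsilon> t. x' t + \<psi>' t *\<^sub>R c \<epsilon>"] C1_family_C0_affine) auto
qed

section \<open>The two ingredients of the variational argument\<close>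

text \<open>Integration by parts moves the derivative from the state to the co-state. What remains under the
  integral depends on the values of \<open>X\<close> only, and the state enters the boundary term at the
  switching time through its value there, which both phases share.\<close>

lemma integral_by_parts_costate:
  fixes X l :: "real \<Rightarrow> real^'n"
  assumes "p < q"
    and X: "\<And>t. t \<in> {p..q} \<Longrightarrow> (X has_vector_derivative X' t) (at t within {p..q})" "continuous_on {p..q} X'"
    and l: "\<And>t. t \<in> {p..q} \<Longrightarrow> (l has_vector_derivative l' t) (at t within {p..q})" "continuous_on {p..q} l'"
    and h: "continuous_on {p..q} h"
  shows "integral {p..q} (\<lambda>t. h t - l t \<bullet> vector_derivative X (at t within {p..q})) =
         integral {p..q} (\<lambda>t. h t + l' t \<bullet> X t) - (l q \<bullet> X q - l p \<bullet> X p)"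
proof -
  have cont: "continuous_on {p..q} X" "continuous_on {p..q} l"
    using continuous_on_vector_derivative X(1) l(1) by blast+
  have "((\<lambda>t. l' t \<bullet> X t + l t \<bullet> X' t) has_integral (l q \<bullet> X q - l p \<bullet> X p)) {p..q}"
  proof (rule fundamental_theorem_of_calculus)
    show "((\<lambda>t. l t \<bullet> X t) has_vector_derivative l' t \<bullet> X t + l t \<bullet> X' t) (at t within {p..q})"
      if "t \<in> {p..q}" for t
      using bounded_bilinear.has_vector_derivative[OF bounded_bilinear_inner l(1)[OF that] X(1)[OF that]]
      by (simp add: algebra_simps)
  qed (use \<open>p < q\<close> in auto)
  moreover have "((\<lambda>t. h t + l' t \<bullet> X t) has_integral integral {p..q} (\<lambda>t. h t + l' t \<bullet> X t)) {p..q}"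
    using h l X cont by (intro integrable_integral integrable_continuous_interval continuous_intros)
  ultimately have "((\<lambda>t. (h t + l' t \<bullet> X t) - (l' t \<bullet> X t + l t \<bullet> X' t)) has_integral
      integral {p..q} (\<lambda>t. h t + l' t \<bullet> X t) - (l q \<bullet> X q - l p \<bullet> X p)) {p..q}"
    by (rule has_integral_diff[rotated])
  then have "integral {p..q} (\<lambda>t. h t - l t \<bullet> X' t) =
      integral {p..q} (\<lambda>t. h t + l' t \<bullet> X t) - (l q \<bullet> X q - l p \<bullet> X p)"
    by (simp add: integral_unique)
  moreover have "integral {p..q} (\<lambda>t. h t - l t \<bullet> vector_derivative X (at t within {p..q})) =
     integral {p..q} (\<lambda>t. h t - l t \<bullet> X' t)"
    by (intro integral_cong) (simp add: vector_derivative_within_closed_interval[OF \<open>p < q\<close> _ X(1)])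
  ultimately show ?thesis by simp
qed

text \<open>The profile \<open>((t - p) / (\<tau> - p)) ^ N\<close> with \<open>N\<close> large: multiplying a perturbation by it
  keeps the boundary point \<open>p\<close> fixed and has full effect at \<open>\<tau>\<close>, while its integral over the
  phase, \<open>\<bar>\<tau> - p\<bar> / (N + 1)\<close>, is arbitrarily small. A power is smooth on the whole line, so the
  same profile also perturbs the extension of a trajectory past \<open>\<tau>\<close>.\<close>

lemma concentrated_profile:
  fixes p \<tau> \<kappa> :: real
  assumes "p \<noteq> \<tau>" "\<kappa> > 0"
  obtains \<psi> \<psi>' :: "real \<Rightarrow> real"
  where "\<And>t. (\<psi> has_real_derivative \<psi>' t) (at t)" "continuous_on UNIV \<psi>'"
    "\<psi> p = 0" "\<psi> \<tau> = 1" "\<And>t. \<bar>t - \<tau>\<bar> < \<bar>p - \<tau>\<bar> \<Longrightarrow> \<psi> t > 0"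
    "\<And>t. t \<in> closed_segment p \<tau> \<Longrightarrow> \<psi> t \<ge> 0" "integral (closed_segment p \<tau>) \<psi> < \<kappa>"
proof -
  obtain N :: nat where N: "\<bar>\<tau> - p\<bar> / \<kappa> < real N" using reals_Archimedean2 by blast
  then have "N > 0" using assms by (cases N) (auto simp: field_simps mult_less_0_iff)
  define \<psi> where "\<psi> t = ((t - p) / (\<tau> - p)) ^ N" for t
  \<comment> \<open>\<open>\<Psi>\<close> is an antiderivative of \<open>\<psi>\<close> that vanishes at \<open>p\<close>.\<close>
  define \<Psi> where "\<Psi> t = (t - p) ^ Suc N / (real (Suc N) * (\<tau> - p) ^ N)" for t
  have \<Psi>: "(\<Psi> has_vector_derivative \<psi> t) (at t within S)" for t S
  proof -
    have "(\<Psi> has_real_derivative (real (Suc N) * (t - p) ^ N) / (real (Suc N) * (\<tau> - p) ^ N)) (at t within S)"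
      unfolding \<Psi>_def using assms
      by (auto intro!: derivative_eq_intros simp del: power_Suc of_nat_Suc)
    then show ?thesis
      by (simp add: \<psi>_def power_divide has_real_derivative_iff_has_vector_derivative del: of_nat_Suc)
  qed
  have "integral (closed_segment p \<tau>) \<psi> = \<bar>\<tau> - p\<bar> / Suc N"
  proof (cases "p < \<tau>")
    case True
    have "(\<psi> has_integral (\<Psi> \<tau> - \<Psi> p)) {p..\<tau>}"
      using True \<Psi> by (intro fundamental_theorem_of_calculus) auto
    with True show ?thesis by (simp add: closed_segment_eq_real_ivl integral_unique \<Psi>_def)
  next
    case False
    have "(\<psi> has_integral (\<Psi> p - \<Psi> \<tau>)) {\<tau>..p}"
      using False \<Psi> by (intro fundamental_theorem_of_calculus) auto
    with False assms show ?thesis by (simp add: closed_segment_eq_real_ivl integral_unique \<Psi>_def minus_divide_left)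
  qed
  also have "\<dots> < \<kappa>" using N assms by (simp add: field_simps)
  finally have int: "integral (closed_segment p \<tau>) \<psi> < \<kappa>" .
  show ?thesis
  proof (rule that)
    show "(\<psi> has_real_derivative (real N * ((t - p) / (\<tau> - p)) ^ (N - 1) / (\<tau> - p))) (at t)" for t
      unfolding \<psi>_def using assms by (auto intro!: derivative_eq_intros)
    show "continuous_on UNIV (\<lambda>t. real N * ((t - p) / (\<tau> - p)) ^ (N - 1) / (\<tau> - p))"
      using assms by (intro continuous_intros) auto
    show "\<psi> p = 0" "\<psi> \<tau> = 1" using \<open>N > 0\<close> assms by (auto simp: \<psi>_def)
    show "\<psi> t > 0" if "\<bar>t - \<tau>\<bar> < \<bar>p - \<tau>\<bar>" for t
      unfolding \<psi>_def using that by (intro zero_less_power) (auto simp: zero_less_divide_iff abs_if split: if_splits)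
    show "\<psi> t \<ge> 0" if "t \<in> closed_segment p \<tau>" for t
      unfolding \<psi>_def using that
      by (intro zero_le_power) (auto simp: zero_le_divide_iff closed_segment_eq_real_ivl split: if_splits)
  qed (fact int)
qed

section \<open>Steering one phase to a prescribed meeting point\<close>

lemma hamiltonian_state_derivative:
  fixes f :: "real^'n \<Rightarrow> real^'m \<Rightarrow> real \<Rightarrow> real^'n" and L :: "real^'n \<Rightarrow> real^'m \<Rightarrow> real \<Rightarrow> real"
    and l :: "real \<Rightarrow> real^'n"
  assumes L: "C1_on (\<lambda>(y, v, t). L y v t) UNIV" and f: "C1_on (\<lambda>(y, v, t). f y v t) UNIV"
    and u: "continuous_on S u" and l: "continuous_on S l"
  obtains H' where
    "\<And>y t. ((\<lambda>y. hamiltonian L f y (l t) (u t) t) has_derivative H' y t) (at y)"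
    "continuous_on (UNIV \<times> S \<times> UNIV) (\<lambda>(y, t, h). H' y t h)"
    "continuous_on (UNIV \<times> S) (\<lambda>(y, t). hamiltonian L f y (l t) (u t) t)"
proof -
  obtain L' where L': "\<And>z. ((\<lambda>(y, v, t). L y v t) has_derivative blinfun_apply (L' z)) (at z)" "continuous_on UNIV L'"
    using L by (auto simp: C1_on_def)
  obtain f' where f': "\<And>z. ((\<lambda>(y, v, t). f y v t) has_derivative blinfun_apply (f' z)) (at z)" "continuous_on UNIV f'"
    using f by (auto simp: C1_on_def)
  define H' where "H' y t h = L' (y, u t, t) (h, 0, 0) + l t \<bullet> f' (y, u t, t) (h, 0, 0)" for y t h
  have emb: "((\<lambda>y. (y, u t, t)) has_derivative (\<lambda>h. (h, 0, 0))) (at y)" for y t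
    by (intro derivative_intros)
  let ?A = "(UNIV :: (real^'n) set) \<times> S \<times> (UNIV :: (real^'n) set)"
  have ut: "continuous_on ?A (\<lambda>p. u (fst (snd p)))" "continuous_on ?A (\<lambda>p. l (fst (snd p)))"
    by (auto intro!: continuous_on_compose2[OF u] continuous_on_compose2[OF l] continuous_intros)
  have ut': "continuous_on (UNIV \<times> S) (\<lambda>p. u (snd p))" "continuous_on (UNIV \<times> S) (\<lambda>p. l (snd p))"
    by (auto intro!: continuous_on_compose2[OF u] continuous_on_compose2[OF l] continuous_intros)
  have contL: "continuous_on UNIV (\<lambda>(y, v, t). L y v t)" and contf: "continuous_on UNIV (\<lambda>(y, v, t). f y v t)"
    using L'(1) f'(1) by (auto intro!: has_derivative_continuous_on)
  show ?thesis
  proof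
    show "((\<lambda>y. hamiltonian L f y (l t) (u t) t) has_derivative H' y t) (at y)" for y t
      unfolding hamiltonian_def H'_def
      using has_derivative_compose[OF emb[of t y] L'(1)] has_derivative_compose[OF emb[of t y] f'(1)]
      by (auto intro!: derivative_eq_intros)
    show "continuous_on (UNIV \<times> S \<times> UNIV) (\<lambda>(y, t, h). H' y t h)"
      unfolding H'_def case_prod_unfold
      by (intro continuous_on_add continuous_on_inner blinfun.continuous_on ut
            continuous_on_compose2[OF L'(2)] continuous_on_compose2[OF f'(2)]
            continuous_on_Pair continuous_on_fst continuous_on_snd continuous_on_id continuous_on_const) auto
    have "continuous_on (UNIV \<times> S) (\<lambda>p. case (fst p, u (snd p), snd p) of (y, v, t) \<Rightarrow> L y v t)"
      "continuous_on (UNIV \<times> S) (\<lambda>p. case (fst p, u (snd p), snd p) of (y, v, t) \<Rightarrow> f y v t)"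
      by (rule continuous_on_compose2[OF contL] continuous_on_compose2[OF contf],
          intro continuous_on_Pair ut' continuous_on_fst continuous_on_snd continuous_on_id, simp)+
    then show "continuous_on (UNIV \<times> S) (\<lambda>(y, t). hamiltonian L f y (l t) (u t) t)"
      unfolding hamiltonian_def case_prod_unfold using ut' by (auto intro!: continuous_on_add continuous_on_inner)
  qed
qed

text \<open>The vector by which the profile \<open>\<psi>\<close> has to be multiplied so that the perturbed trajectory is at
  \<open>x \<tau> + \<epsilon> v\<close> at the perturbed switching time \<open>\<tau> + s \<epsilon>\<close>. Prescribing this common target, instead of
  the perturbations themselves, makes the two phases meet exactly for every \<open>\<epsilon>\<close>.\<close>

definition steering_coefficient :: "(real \<Rightarrow> 'a::real_normed_vector) \<Rightarrow> (real \<Rightarrow> real) \<Rightarrow> real \<Rightarrow> real \<Rightarrow> 'a \<Rightarrow> real \<Rightarrow> 'a" where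
  "steering_coefficient x \<psi> \<tau> s v \<epsilon> =
     inverse (\<psi> (\<tau> + s * \<epsilon>)) *\<^sub>R (x \<tau> + \<epsilon> *\<^sub>R v - x (\<tau> + s * \<epsilon>))"

definition steered :: "(real \<Rightarrow> 'a::real_normed_vector) \<Rightarrow> (real \<Rightarrow> real) \<Rightarrow> real \<Rightarrow> real \<Rightarrow> 'a \<Rightarrow> real \<Rightarrow> real \<Rightarrow> 'a" where
  "steered x \<psi> \<tau> s v \<epsilon> t = x t + \<psi> t *\<^sub>R steering_coefficient x \<psi> \<tau> s v \<epsilon>"

lemma steered_meets:
  "\<psi> (\<tau> + s * \<epsilon>) \<noteq> 0 \<Longrightarrow> steered x \<psi> \<tau> s v \<epsilon> (\<tau> + s * \<epsilon>) = x \<tau> + \<epsilon> *\<^sub>R v"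
  by (simp add: steered_def steering_coefficient_def)

lemma steered_0: "steered x \<psi> \<tau> s v 0 = x"
  by (simp add: steered_def steering_coefficient_def fun_eq_iff)

text \<open>The initial speed \<open>v - s *\<^sub>R x' \<tau>\<close> of the coefficient does not depend on the profile. Hence the
  perturbation stays bounded while the profile becomes concentrated.\<close>

lemma steering_coefficient_C1:
  fixes x :: "real \<Rightarrow> 'a::real_normed_vector"
  assumes x: "\<And>t. t \<in> {a..b} \<Longrightarrow> (x has_vector_derivative x' t) (at t within {a..b})" "continuous_on {a..b} x'"
    and \<psi>: "\<And>t. (\<psi> has_real_derivative \<psi>' t) (at t)" "continuous_on UNIV \<psi>'" "\<psi> \<tau> = 1"
    and I: "0 \<in> I" "\<And>\<epsilon>. \<epsilon> \<in> I \<Longrightarrow> \<tau> + s * \<epsilon> \<in> {a<..<b} \<and> \<psi> (\<tau> + s * \<epsilon>) \<noteq> 0"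
  obtains c' where
    "\<And>\<epsilon>. \<epsilon> \<in> I \<Longrightarrow> (steering_coefficient x \<psi> \<tau> s v has_vector_derivative c' \<epsilon>) (at \<epsilon>)"
    "continuous_on I c'" "c' 0 = v - s *\<^sub>R x' \<tau>"
proof
  define T where "T \<epsilon> = \<tau> + s * \<epsilon>" for \<epsilon>
  have T: "(T has_real_derivative s) (at \<epsilon>)" "continuous_on A T" for \<epsilon> A
    unfolding T_def by (auto intro!: derivative_eq_intros, intro continuous_intros)
  define c' where "c' \<epsilon> = inverse (\<psi> (T \<epsilon>)) *\<^sub>R (v - s *\<^sub>R x' (T \<epsilon>))
     + (- (inverse (\<psi> (T \<epsilon>)) * (\<psi>' (T \<epsilon>) * s) * inverse (\<psi> (T \<epsilon>)))) *\<^sub>R (x \<tau> + \<epsilon> *\<^sub>R v - x (T \<epsilon>))" for \<epsilon>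
  have x_at: "(x has_vector_derivative x' t) (at t)" if "t \<in> {a<..<b}" for t
    using has_vector_derivative_within_subset[OF x(1), of t "{a<..<b}"] that
    by (simp add: at_within_open_NO_MATCH subset_eq)
  show "(steering_coefficient x \<psi> \<tau> s v has_vector_derivative c' \<epsilon>) (at \<epsilon>)" if "\<epsilon> \<in> I" for \<epsilon>
  proof -
    have "((\<lambda>\<epsilon>. x (T \<epsilon>)) has_vector_derivative s *\<^sub>R x' (T \<epsilon>)) (at \<epsilon>)"
      using vector_diff_chain_at[of T s \<epsilon> x "x' (T \<epsilon>)"] T(1) x_at I(2)[OF that]
      by (simp add: has_real_derivative_iff_has_vector_derivative o_def T_def)
    moreover have "((\<lambda>\<epsilon>. x \<tau> + \<epsilon> *\<^sub>R v) has_vector_derivative v) (at \<epsilon>)"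
      by (auto intro!: derivative_eq_intros)
    moreover have "((\<lambda>\<epsilon>. inverse (\<psi> (T \<epsilon>))) has_real_derivative
        - (inverse (\<psi> (T \<epsilon>)) * (\<psi>' (T \<epsilon>) * s) * inverse (\<psi> (T \<epsilon>)))) (at \<epsilon>)"
      using I(2)[OF that] by (intro DERIV_inverse' DERIV_chain2[OF \<psi>(1) T(1)]) (simp add: T_def)
    ultimately have "((\<lambda>\<epsilon>. inverse (\<psi> (T \<epsilon>)) *\<^sub>R (x \<tau> + \<epsilon> *\<^sub>R v - x (T \<epsilon>))) has_vector_derivative
        inverse (\<psi> (T \<epsilon>)) *\<^sub>R (v - s *\<^sub>R x' (T \<epsilon>))
        + (- (inverse (\<psi> (T \<epsilon>)) * (\<psi>' (T \<epsilon>) * s) * inverse (\<psi> (T \<epsilon>)))) *\<^sub>R (x \<tau> + \<epsilon> *\<^sub>R v - x (T \<epsilon>))) (at \<epsilon>)"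
      by (intro has_vector_derivative_scaleR has_vector_derivative_diff)
    then have "((\<lambda>\<epsilon>. inverse (\<psi> (T \<epsilon>)) *\<^sub>R (x \<tau> + \<epsilon> *\<^sub>R v - x (T \<epsilon>))) has_vector_derivative c' \<epsilon>) (at \<epsilon>)"
      by (simp add: c'_def)
    then show ?thesis
      unfolding T_def steering_coefficient_def[abs_def] .
  qed
  have "continuous_on {a..b} x" using continuous_on_vector_derivative x(1) by blast
  moreover have "continuous_on UNIV \<psi>" by (rule DERIV_continuous_on[OF has_field_derivative_at_within[OF \<psi>(1)]])
  moreover have "continuous_on I (\<lambda>\<epsilon>. h (T \<epsilon>))" if "continuous_on {a..b} h" for h :: "real \<Rightarrow> 'a"
    by (rule continuous_on_compose2[OF that T(2)]) (use I(2) in \<open>force simp: T_def\<close>)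
  moreover have "continuous_on I (\<lambda>\<epsilon>. h (T \<epsilon>))" if "continuous_on UNIV h" for h :: "real \<Rightarrow> real"
    by (rule continuous_on_compose2[OF that T(2)]) simp
  ultimately have "continuous_on I (\<lambda>\<epsilon>. x (T \<epsilon>))" "continuous_on I (\<lambda>\<epsilon>. x' (T \<epsilon>))"
    "continuous_on I (\<lambda>\<epsilon>. \<psi> (T \<epsilon>))" "continuous_on I (\<lambda>\<epsilon>. \<psi>' (T \<epsilon>))"
    using x(2) \<psi>(2) by blast+
  then show "continuous_on I c'"
    unfolding c'_def using I(2) by (intro continuous_intros) (auto simp: T_def)
  show "c' 0 = v - s *\<^sub>R x' \<tau>" by (simp add: c'_def T_def \<psi>(3))
qed

section \<open>First variation of the cost of one phase\<close>

definition phase_cost ::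
  "(real^'n \<Rightarrow> real^'m \<Rightarrow> real \<Rightarrow> real) \<Rightarrow> (real^'n \<Rightarrow> real^'m \<Rightarrow> real \<Rightarrow> real^'n) \<Rightarrow>
   (real \<Rightarrow> real^'n) \<Rightarrow> (real \<Rightarrow> real^'m) \<Rightarrow> real \<Rightarrow> real \<Rightarrow> (real \<Rightarrow> real^'n) \<Rightarrow> real" where
  "phase_cost L f l u p q X =
     integral {p..q} (\<lambda>t. hamiltonian L f (X t) (l t) (u t) t - l t \<bullet> vector_derivative X (at t within {p..q}))"

text \<open>After integration by parts the cost of the phase is the integral of
  \<open>H(X, l, u, t) + l' \<bullet> X\<close> plus boundary terms. Moving the endpoint contributes
  \<open>(H + l' \<bullet> x) s\<close> at \<open>\<tau>\<close>, the boundary term contributes \<open>- (l \<bullet> v + s (l' \<bullet> x))\<close>, and the terms with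
  \<open>l' \<bullet> x\<close> cancel; the second phase has the opposite signs. The factor \<open>k\<close> is the state derivative of
  the integrand in the direction \<open>v - s *\<^sub>R x' \<tau>\<close>. That it is chosen before the profile is
  essential: the integral of \<open>\<psi> t * k t\<close> can then be made small by the choice of \<open>\<psi>\<close>.\<close>

lemma phase_cost_derivative:
  fixes f :: "real^'n \<Rightarrow> real^'m \<Rightarrow> real \<Rightarrow> real^'n" and L :: "real^'n \<Rightarrow> real^'m \<Rightarrow> real \<Rightarrow> real"
    and x l :: "real \<Rightarrow> real^'n"
  assumes L: "C1_on (\<lambda>(y, v, t). L y v t) UNIV" and f: "C1_on (\<lambda>(y, v, t). f y v t) UNIV"
    and x: "C1_on x {a..b}" and l: "C1_on l {a..b}" and u: "continuous_on {a..b} u"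
    and ab: "a < \<tau>" "\<tau> < b" and \<delta>: "\<delta> > 0"
  obtains k where "continuous_on {a..b} k"
    "\<And>\<psi> \<psi>'. (\<And>t. (\<psi> has_real_derivative \<psi>' t) (at t)) \<Longrightarrow> continuous_on UNIV \<psi>' \<Longrightarrow> \<psi> \<tau> = 1 \<Longrightarrow>
       (\<And>\<epsilon>. \<epsilon> \<in> {-\<delta><..<\<delta>} \<Longrightarrow> \<tau> + s * \<epsilon> \<in> {a<..<b} \<and> \<psi> (\<tau> + s * \<epsilon>) \<noteq> 0) \<Longrightarrow>
       C1_family_C1 {-\<delta><..<\<delta>} {a..b} (steered x \<psi> \<tau> s v) \<and>
       (\<psi> a = 0 \<longrightarrow> ((\<lambda>\<epsilon>. phase_cost L f l u a (\<tau> + s * \<epsilon>) (steered x \<psi> \<tau> s v \<epsilon>)) has_real_derivative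
          hamiltonian L f (x \<tau>) (l \<tau>) (u \<tau>) \<tau> * s - l \<tau> \<bullet> v + integral {a..\<tau>} (\<lambda>t. \<psi> t * k t)) (at 0)) \<and>
       (\<psi> b = 0 \<longrightarrow> ((\<lambda>\<epsilon>. phase_cost L f l u (\<tau> + s * \<epsilon>) b (steered x \<psi> \<tau> s v \<epsilon>)) has_real_derivative
          l \<tau> \<bullet> v - hamiltonian L f (x \<tau>) (l \<tau>) (u \<tau>) \<tau> * s + integral {\<tau>..b} (\<lambda>t. \<psi> t * k t)) (at 0))"
proof -
  define I where "I = {-\<delta><..<\<delta>}"
  have I: "0 \<in> I" "open I" using \<delta> by (auto simp: I_def)
  obtain x' where x': "\<And>t. t \<in> {a..b} \<Longrightarrow> (x has_vector_derivative x' t) (at t within {a..b})" "continuous_on {a..b} x'"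
    using C1_on_real_obtain[OF x] by blast
  obtain l' where l': "\<And>t. t \<in> {a..b} \<Longrightarrow> (l has_vector_derivative l' t) (at t within {a..b})" "continuous_on {a..b} l'"
    using C1_on_real_obtain[OF l] by blast
  have xc: "continuous_on {a..b} x" and lc: "continuous_on {a..b} l"
    using x'(1) l'(1) continuous_on_vector_derivative by blast+
  define H where "H y t = hamiltonian L f y (l t) (u t) t" for y t
  obtain H' where H': "\<And>y t. ((\<lambda>y. H y t) has_derivative H' y t) (at y)"
    "continuous_on (UNIV \<times> {a..b} \<times> UNIV) (\<lambda>(y, t, h). H' y t h)"
    "continuous_on (UNIV \<times> {a..b}) (\<lambda>(y, t). H y t)"
    using hamiltonian_state_derivative[OF L f u lc] unfolding H_def by blast
  define w where "w = v - s *\<^sub>R x' \<tau>"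
  define k where "k t = H' (x t) t w + l' t \<bullet> w" for t
  have H'_comp: "continuous_on A (\<lambda>z. H' (Y z) (t z) (h z))"
    if "continuous_on A Y" "continuous_on A t" "continuous_on A h" "t ` A \<subseteq> {a..b}" for A Y t h
  proof -
    have "continuous_on A (\<lambda>z. case (Y z, t z, h z) of (y, t, h) \<Rightarrow> H' y t h)"
      by (rule continuous_on_compose2[OF H'(2)]) (use that in \<open>auto intro: continuous_on_Pair\<close>)
    then show ?thesis by simp
  qed
  have H_comp: "continuous_on A (\<lambda>z. H (Y z) (t z))"
    if "continuous_on A Y" "continuous_on A t" "t ` A \<subseteq> {a..b}" for A Y t
  proof -
    have "continuous_on A (\<lambda>z. case (Y z, t z) of (y, t) \<Rightarrow> H y t)"
      by (rule continuous_on_compose2[OF H'(3)]) (use that in \<open>auto intro: continuous_on_Pair\<close>)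
    then show ?thesis by simp
  qed
  show ?thesis
  proof (rule that[of k])
    show "continuous_on {a..b} k"
      unfolding k_def using xc l'(2) by (intro continuous_on_add continuous_on_inner H'_comp) (auto intro: continuous_intros)
  next
    fix \<psi> \<psi>' :: "real \<Rightarrow> real"
    assume \<psi>: "\<And>t. (\<psi> has_real_derivative \<psi>' t) (at t)" "continuous_on UNIV \<psi>'" "\<psi> \<tau> = 1"
      and I\<psi>: "\<And>\<epsilon>. \<epsilon> \<in> {-\<delta><..<\<delta>} \<Longrightarrow> \<tau> + s * \<epsilon> \<in> {a<..<b} \<and> \<psi> (\<tau> + s * \<epsilon>) \<noteq> 0"
    define X where "X = steered x \<psi> \<tau> s v"
    define c where "c = steering_coefficient x \<psi> \<tau> s v"
    have X_eq: "X = (\<lambda>\<epsilon> t. x t + \<psi> t *\<^sub>R c \<epsilon>)"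
      by (simp add: X_def c_def steered_def fun_eq_iff)
    have X0: "X 0 = x" by (simp add: X_def steered_0)
    obtain c' where c': "\<And>\<epsilon>. \<epsilon> \<in> I \<Longrightarrow> (c has_vector_derivative c' \<epsilon>) (at \<epsilon>)"
        "continuous_on I c'" "c' 0 = w"
      using steering_coefficient_C1[OF x' \<psi> I(1), of s v] I\<psi> unfolding c_def w_def I_def by blast
    have \<psi>c: "continuous_on {a..b} \<psi>" "continuous_on {a..b} \<psi>'"
      using DERIV_continuous_on[OF has_field_derivative_at_within[OF \<psi>(1)]] continuous_on_subset[OF \<psi>(2)]
      by blast+
    have \<psi>within: "(\<psi> has_real_derivative \<psi>' t) (at t within A)" for t A
      using \<psi>(1) by (rule has_field_derivative_at_within)
    have fam: "C1_family_C1 I {a..b} X"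
      unfolding X_eq using x' \<psi>within \<psi>c(2) c'(1,2) by (rule C1_family_C1_affine)
    have Xder: "(X \<epsilon> has_vector_derivative x' t + \<psi>' t *\<^sub>R c \<epsilon>) (at t within {a..b})" if "t \<in> {a..b}" for \<epsilon> t
      unfolding X_eq using x'(1)[OF that] \<psi>within[of t "{a..b}"] by (auto intro!: derivative_eq_intros)
    have X'c: "continuous_on {a..b} (\<lambda>t. x' t + \<psi>' t *\<^sub>R c \<epsilon>)" for \<epsilon>
      using x' \<psi>c by (intro continuous_intros)
    have Xc: "continuous_on {a..b} (X \<epsilon>)" for \<epsilon>
      unfolding X_eq using xc \<psi>c by (intro continuous_intros)
    define G where "G \<epsilon> t = H (X \<epsilon> t) t + l' t \<bullet> X \<epsilon> t" for \<epsilon> t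
    define D where "D \<epsilon> t = H' (X \<epsilon> t) t (\<psi> t *\<^sub>R c' \<epsilon>) + l' t \<bullet> (\<psi> t *\<^sub>R c' \<epsilon>)" for \<epsilon> t
    have der: "((\<lambda>e. G e t) has_real_derivative D \<epsilon> t) (at \<epsilon>)" if "\<epsilon> \<in> I" for \<epsilon> t
    proof -
      have "((\<lambda>e. X e t) has_derivative (\<lambda>r. r *\<^sub>R \<psi> t *\<^sub>R c' \<epsilon>)) (at \<epsilon>)"
        unfolding X_eq has_vector_derivative_def[symmetric] using c'(1)[OF that]
        by (auto intro!: derivative_eq_intros)
      note * = this has_derivative_compose[OF this H'(1)[of t]]
      have "H' (X \<epsilon> t) t (r *\<^sub>R y) = r * H' (X \<epsilon> t) t y" for r y
        using linear_scale[OF has_derivative_linear[OF H'(1)]] by simp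
      then show ?thesis
        unfolding has_field_derivative_def G_def D_def
        using * by (auto intro!: derivative_eq_intros simp: algebra_simps)
    qed
    have pc: "continuous_on (I \<times> {a..b}) (\<lambda>p. h (snd p))" if "continuous_on {a..b} h" for h :: "real \<Rightarrow> 'z::topological_space"
      using that by (rule continuous_on_compose2) (auto intro: continuous_on_snd)
    have pc1: "continuous_on (I \<times> {a..b}) (\<lambda>p. c' (fst p))"
      using c'(2) by (rule continuous_on_compose2) (auto intro: continuous_on_fst)
    have pX: "continuous_on (I \<times> {a..b}) (\<lambda>p. X (fst p) (snd p))"
      using fam by (simp add: C1_family_C1_def C1_family_C0_def case_prod_unfold)
    have contG: "continuous_on (I \<times> {a..b}) (\<lambda>(\<epsilon>, t). G \<epsilon> t)"
      unfolding G_def case_prod_unfold using pX l'(2)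
      by (intro continuous_on_add continuous_on_inner H_comp pc continuous_on_snd continuous_on_id) auto
    have contD: "continuous_on (I \<times> {a..b}) (\<lambda>(\<epsilon>, t). D \<epsilon> t)"
      unfolding D_def case_prod_unfold using pX l'(2) pc1 \<psi>c
      by (intro continuous_on_add continuous_on_inner continuous_on_scaleR H'_comp pc continuous_on_snd continuous_on_id) auto
    have D0: "D 0 = (\<lambda>t. \<psi> t * k t)"
    proof
      fix t
      have "H' (x t) t (r *\<^sub>R w) = r * H' (x t) t w" for r
        using linear_scale[OF has_derivative_linear[OF H'(1)]] by simp
      then show "D 0 t = \<psi> t * k t"
        by (simp add: D_def k_def X0 c'(3) algebra_simps)
    qed
    have G0: "G 0 \<tau> = hamiltonian L f (x \<tau>) (l \<tau>) (u \<tau>) \<tau> + l' \<tau> \<bullet> x \<tau>"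
      by (simp add: G_def X0 H_def)
    define T where "T \<epsilon> = \<tau> + s * \<epsilon>" for \<epsilon>
    have T: "(T has_real_derivative s) (at 0)" "T 0 = \<tau>"
      unfolding T_def by (auto intro!: derivative_eq_intros)
    have X_T: "X \<epsilon> (T \<epsilon>) = x \<tau> + \<epsilon> *\<^sub>R v" if "\<epsilon> \<in> I" for \<epsilon>
      using I\<psi>[of \<epsilon>] that steered_meets unfolding X_def T_def I_def by blast
    have parts: "phase_cost L f l u p q (X \<epsilon>) = integral {p..q} (G \<epsilon>) - (l q \<bullet> X \<epsilon> q - l p \<bullet> X \<epsilon> p)"
      if "a \<le> p" "p < q" "q \<le> b" for \<epsilon> p q
    proof -
      have sub: "{p..q} \<subseteq> {a..b}" using that by auto
      show ?thesis
        unfolding phase_cost_def G_def H_def[symmetric]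
      proof (rule integral_by_parts_costate[OF \<open>p < q\<close>])
        show "continuous_on {p..q} (\<lambda>t. H (X \<epsilon> t) t)"
          using continuous_on_subset[OF Xc sub] sub by (intro H_comp) (auto intro: continuous_on_id)
        show "(X \<epsilon> has_vector_derivative x' t + \<psi>' t *\<^sub>R c \<epsilon>) (at t within {p..q})"
          "(l has_vector_derivative l' t) (at t within {p..q})" if "t \<in> {p..q}" for t
          using that sub has_vector_derivative_within_subset[OF Xder sub]
            has_vector_derivative_within_subset[OF l'(1) sub] by blast+
      qed (use sub X'c l'(2) continuous_on_subset in blast)+
    qed
    have "(l has_vector_derivative l' \<tau>) (at \<tau>)"
      using has_vector_derivative_within_subset[OF l'(1), of \<tau> "{a<..<b}"] ab
      by (simp add: at_within_open_NO_MATCH subset_eq)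
    then have "((\<lambda>\<epsilon>. l (T \<epsilon>)) has_vector_derivative s *\<^sub>R l' \<tau>) (at 0)"
      using vector_diff_chain_at[of T s 0 l "l' \<tau>"] T
      by (simp add: has_real_derivative_iff_has_vector_derivative o_def)
    moreover have "((\<lambda>\<epsilon>. x \<tau> + \<epsilon> *\<^sub>R v) has_vector_derivative v) (at 0)"
      by (auto intro!: derivative_eq_intros)
    ultimately have bdry: "((\<lambda>\<epsilon>. l (T \<epsilon>) \<bullet> (x \<tau> + \<epsilon> *\<^sub>R v)) has_real_derivative (l \<tau> \<bullet> v + s * (l' \<tau> \<bullet> x \<tau>))) (at 0)"
      using bounded_bilinear.has_vector_derivative[OF bounded_bilinear_inner] T(2)
      by (fastforce simp: has_real_derivative_iff_has_vector_derivative)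
    have near0: "\<forall>\<^sub>F \<epsilon> in nhds 0. \<epsilon> \<in> I"
      using I eventually_nhds_in_open by blast
    have "((\<lambda>\<epsilon>. phase_cost L f l u a (T \<epsilon>) (X \<epsilon>)) has_real_derivative
          hamiltonian L f (x \<tau>) (l \<tau>) (u \<tau>) \<tau> * s - l \<tau> \<bullet> v + integral {a..\<tau>} (\<lambda>t. \<psi> t * k t)) (at 0)"
      if "\<psi> a = 0"
    proof -
      have Xa: "X \<epsilon> a = x a" for \<epsilon> using that by (simp add: X_eq)
      have "\<forall>\<^sub>F \<epsilon> in nhds 0. phase_cost L f l u a (T \<epsilon>) (X \<epsilon>) =
          integral {a..T \<epsilon>} (G \<epsilon>) - (l (T \<epsilon>) \<bullet> (x \<tau> + \<epsilon> *\<^sub>R v) - l a \<bullet> x a)"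
        using near0
      proof eventually_elim
        case (elim \<epsilon>)
        then show ?case using parts[of a "T \<epsilon>" \<epsilon>] I\<psi>[of \<epsilon>] X_T[of \<epsilon>] by (simp add: Xa T_def I_def)
      qed
      moreover have "((\<lambda>\<epsilon>. integral {a..T \<epsilon>} (G \<epsilon>) - (l (T \<epsilon>) \<bullet> (x \<tau> + \<epsilon> *\<^sub>R v) - l a \<bullet> x a)) has_real_derivative
         (integral {a..\<tau>} (D 0) + G 0 \<tau> * s - (l \<tau> \<bullet> v + s * (l' \<tau> \<bullet> x \<tau>) - 0))) (at 0)"
        using \<delta> ab der contG contD T unfolding I_def
        by (intro DERIV_diff leibniz_moving_upper bdry DERIV_const) auto
      ultimately have "((\<lambda>\<epsilon>. phase_cost L f l u a (T \<epsilon>) (X \<epsilon>)) has_real_derivative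
         (integral {a..\<tau>} (D 0) + G 0 \<tau> * s - (l \<tau> \<bullet> v + s * (l' \<tau> \<bullet> x \<tau>) - 0))) (at 0)"
        by (simp add: DERIV_cong_ev[OF refl _ refl])
      then show ?thesis by (simp add: D0 G0 algebra_simps)
    qed
    moreover have "((\<lambda>\<epsilon>. phase_cost L f l u (T \<epsilon>) b (X \<epsilon>)) has_real_derivative
          l \<tau> \<bullet> v - hamiltonian L f (x \<tau>) (l \<tau>) (u \<tau>) \<tau> * s + integral {\<tau>..b} (\<lambda>t. \<psi> t * k t)) (at 0)"
      if "\<psi> b = 0"
    proof -
      have Xb: "X \<epsilon> b = x b" for \<epsilon> using that by (simp add: X_eq)
      have "\<forall>\<^sub>F \<epsilon> in nhds 0. phase_cost L f l u (T \<epsilon>) b (X \<epsilon>) =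
          integral {T \<epsilon>..b} (G \<epsilon>) - (l b \<bullet> x b - l (T \<epsilon>) \<bullet> (x \<tau> + \<epsilon> *\<^sub>R v))"
        using near0
      proof eventually_elim
        case (elim \<epsilon>)
        then show ?case using parts[of "T \<epsilon>" b \<epsilon>] I\<psi>[of \<epsilon>] X_T[of \<epsilon>] by (simp add: Xb T_def I_def)
      qed
      moreover have "((\<lambda>\<epsilon>. integral {T \<epsilon>..b} (G \<epsilon>) - (l b \<bullet> x b - l (T \<epsilon>) \<bullet> (x \<tau> + \<epsilon> *\<^sub>R v))) has_real_derivative
         (integral {\<tau>..b} (D 0) - G 0 \<tau> * s - (0 - (l \<tau> \<bullet> v + s * (l' \<tau> \<bullet> x \<tau>))))) (at 0)"
        using \<delta> ab der contG contD T unfolding I_def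
        by (intro DERIV_diff leibniz_moving_lower bdry DERIV_const) auto
      ultimately have "((\<lambda>\<epsilon>. phase_cost L f l u (T \<epsilon>) b (X \<epsilon>)) has_real_derivative
         (integral {\<tau>..b} (D 0) - G 0 \<tau> * s - (0 - (l \<tau> \<bullet> v + s * (l' \<tau> \<bullet> x \<tau>))))) (at 0)"
        by (simp add: DERIV_cong_ev[OF refl _ refl])
      then show ?thesis by (simp add: D0 G0 algebra_simps)
    qed
    ultimately show "C1_family_C1 {-\<delta><..<\<delta>} {a..b} (steered x \<psi> \<tau> s v) \<and>
       (\<psi> a = 0 \<longrightarrow> ((\<lambda>\<epsilon>. phase_cost L f l u a (\<tau> + s * \<epsilon>) (steered x \<psi> \<tau> s v \<epsilon>)) has_real_derivative
          hamiltonian L f (x \<tau>) (l \<tau>) (u \<tau>) \<tau> * s - l \<tau> \<bullet> v + integral {a..\<tau>} (\<lambda>t. \<psi> t * k t)) (at 0)) \<and>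
       (\<psi> b = 0 \<longrightarrow> ((\<lambda>\<epsilon>. phase_cost L f l u (\<tau> + s * \<epsilon>) b (steered x \<psi> \<tau> s v \<epsilon>)) has_real_derivative
          l \<tau> \<bullet> v - hamiltonian L f (x \<tau>) (l \<tau>) (u \<tau>) \<tau> * s + integral {\<tau>..b} (\<lambda>t. \<psi> t * k t)) (at 0))"
      using fam unfolding X_def T_def I_def by blast
  qed
qed

text \<open>The two cases of \<open>p\<close> are the two phases: \<open>p = a\<close> is a phase that starts at \<open>a\<close> and is left at the
  switching time, \<open>p = b\<close> one that is entered at the switching time and ends at \<open>b\<close>. The error \<open>D\<close>
  is the contribution of the interior of the phase. It is small because the profile is
  concentrated near \<open>\<tau>\<close>.\<close>

lemma phase_variation:
  fixes f :: "real^'n \<Rightarrow> real^'m \<Rightarrow> real \<Rightarrow> real^'n" and L :: "real^'n \<Rightarrow> real^'m \<Rightarrow> real \<Rightarrow> real"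
    and x l :: "real \<Rightarrow> real^'n"
  assumes L: "C1_on (\<lambda>(y, v, t). L y v t) UNIV" and f: "C1_on (\<lambda>(y, v, t). f y v t) UNIV"
    and x: "C1_on x {a..b}" and l: "C1_on l {a..b}" and u: "continuous_on {a..b} u"
    and ab: "a < \<tau>" "\<tau> < b" and \<delta>: "\<delta> > 0"
    and s: "\<And>\<epsilon>. \<bar>\<epsilon>\<bar> < \<delta> \<Longrightarrow> \<bar>s * \<epsilon>\<bar> < min (\<tau> - a) (b - \<tau>)"
    and p: "p \<in> {a, b}" and \<kappa>: "\<kappa> > 0"
  obtains X D where
    "C1_family_C1 {-\<delta><..<\<delta>} {a..b} X" "X 0 = x"
    "\<And>\<epsilon>. X \<epsilon> p = x p" "\<And>\<epsilon>. \<epsilon> \<in> {-\<delta><..<\<delta>} \<Longrightarrow> X \<epsilon> (\<tau> + s * \<epsilon>) = x \<tau> + \<epsilon> *\<^sub>R v"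
    "p = a \<Longrightarrow> ((\<lambda>\<epsilon>. phase_cost L f l u a (\<tau> + s * \<epsilon>) (X \<epsilon>)) has_real_derivative
       hamiltonian L f (x \<tau>) (l \<tau>) (u \<tau>) \<tau> * s - l \<tau> \<bullet> v + D) (at 0)"
    "p = b \<Longrightarrow> ((\<lambda>\<epsilon>. phase_cost L f l u (\<tau> + s * \<epsilon>) b (X \<epsilon>)) has_real_derivative
       l \<tau> \<bullet> v - hamiltonian L f (x \<tau>) (l \<tau>) (u \<tau>) \<tau> * s + D) (at 0)"
    "\<bar>D\<bar> < \<kappa>"
proof -
  from phase_cost_derivative[OF L f x l u ab \<delta>, of s v]
  obtain k where k: "continuous_on {a..b} k" and
    deriv: "\<And>\<psi> \<psi>'. (\<And>t. (\<psi> has_real_derivative \<psi>' t) (at t)) \<Longrightarrow> continuous_on UNIV \<psi>' \<Longrightarrow> \<psi> \<tau> = 1 \<Longrightarrow>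
       (\<And>\<epsilon>. \<epsilon> \<in> {-\<delta><..<\<delta>} \<Longrightarrow> \<tau> + s * \<epsilon> \<in> {a<..<b} \<and> \<psi> (\<tau> + s * \<epsilon>) \<noteq> 0) \<Longrightarrow>
       C1_family_C1 {-\<delta><..<\<delta>} {a..b} (steered x \<psi> \<tau> s v) \<and>
       (\<psi> a = 0 \<longrightarrow> ((\<lambda>\<epsilon>. phase_cost L f l u a (\<tau> + s * \<epsilon>) (steered x \<psi> \<tau> s v \<epsilon>)) has_real_derivative
          hamiltonian L f (x \<tau>) (l \<tau>) (u \<tau>) \<tau> * s - l \<tau> \<bullet> v + integral {a..\<tau>} (\<lambda>t. \<psi> t * k t)) (at 0)) \<and>
       (\<psi> b = 0 \<longrightarrow> ((\<lambda>\<epsilon>. phase_cost L f l u (\<tau> + s * \<epsilon>) b (steered x \<psi> \<tau> s v \<epsilon>)) has_real_derivative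
          l \<tau> \<bullet> v - hamiltonian L f (x \<tau>) (l \<tau>) (u \<tau>) \<tau> * s + integral {\<tau>..b} (\<lambda>t. \<psi> t * k t)) (at 0))"
    by blast
  have "bounded (k ` {a..b})"
    using k by (intro compact_imp_bounded compact_continuous_image) auto
  then obtain M where M: "M > 0" "\<And>t. t \<in> {a..b} \<Longrightarrow> \<bar>k t\<bar> \<le> M"
    by (auto simp: bounded_pos)
  have "p \<noteq> \<tau>" "\<kappa> / M > 0" using p ab \<kappa> M by auto
  then obtain \<psi> \<psi>' where \<psi>: "\<And>t. (\<psi> has_real_derivative \<psi>' t) (at t)" "continuous_on UNIV \<psi>'"
    "\<psi> p = 0" "\<psi> \<tau> = 1" "\<And>t. \<bar>t - \<tau>\<bar> < \<bar>p - \<tau>\<bar> \<Longrightarrow> \<psi> t > 0"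
    "\<And>t. t \<in> closed_segment p \<tau> \<Longrightarrow> \<psi> t \<ge> 0" "integral (closed_segment p \<tau>) \<psi> < \<kappa> / M"
    using concentrated_profile[of p \<tau> "\<kappa> / M"] by metis
  have pos: "\<tau> + s * \<epsilon> \<in> {a<..<b} \<and> \<psi> (\<tau> + s * \<epsilon>) \<noteq> 0" if "\<epsilon> \<in> {-\<delta><..<\<delta>}" for \<epsilon>
  proof -
    have *: "\<bar>s * \<epsilon>\<bar> < min (\<tau> - a) (b - \<tau>)" using s that by auto
    moreover have "min (\<tau> - a) (b - \<tau>) \<le> \<bar>p - \<tau>\<bar>" using p ab by auto
    ultimately have "\<psi> (\<tau> + s * \<epsilon>) > 0" by (intro \<psi>(5)) auto
    then show ?thesis using * by auto
  qed
  let ?J = "closed_segment p \<tau>"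
  have J: "?J = (if p = a then {a..\<tau>} else {\<tau>..b})"
    using p ab by (auto simp: closed_segment_eq_real_ivl)
  have sub: "?J \<subseteq> {a..b}" using J ab by auto
  have \<psi>c: "continuous_on A \<psi>" for A
    by (rule DERIV_continuous_on[OF has_field_derivative_at_within[OF \<psi>(1)]])
  have iv: "h integrable_on ?J" if "continuous_on ?J h" for h :: "real \<Rightarrow> real"
    using that unfolding J by (auto intro: integrable_continuous_interval split: if_splits)
  have "norm (integral ?J (\<lambda>t. \<psi> t * k t)) \<le> integral ?J (\<lambda>t. \<psi> t * M)"
  proof (rule integral_norm_bound_integral)
    show "norm (\<psi> t * k t) \<le> \<psi> t * M" if "t \<in> ?J" for t
      using M(2)[of t] \<psi>(6)[OF that] sub that by (auto simp: abs_mult intro!: mult_left_mono)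
  qed (intro iv continuous_on_mult \<psi>c continuous_on_subset[OF k sub] continuous_on_const)+
  also have "\<dots> < \<kappa>" using \<psi>(7) M(1) by (simp add: field_simps)
  finally have small: "\<bar>integral ?J (\<lambda>t. \<psi> t * k t)\<bar> < \<kappa>" by simp
  show ?thesis
  proof (rule that[of "steered x \<psi> \<tau> s v" "integral ?J (\<lambda>t. \<psi> t * k t)"])
    show "steered x \<psi> \<tau> s v \<epsilon> p = x p" for \<epsilon> by (simp add: steered_def \<psi>(3))
    show "steered x \<psi> \<tau> s v \<epsilon> (\<tau> + s * \<epsilon>) = x \<tau> + \<epsilon> *\<^sub>R v" if "\<epsilon> \<in> {-\<delta><..<\<delta>}" for \<epsilon>
      using pos[OF that] steered_meets by blast
  qed (use deriv[OF \<psi>(1,2,4) pos] \<psi>(3) J ab small in \<open>auto simp: steered_0\<close>)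
qed

section \<open>Stationarity at the switching time and the jump law\<close>

text \<open>The Weierstrass-Erdmann corner conditions in one formula: \<open>v\<close> is the speed of the
  crossing point and \<open>s\<close> that of the crossing time. The crossing point is not constrained to the
  interface, whose equation is taken care of by the multiplier \<open>\<nu>\<close>; therefore \<open>v\<close> and \<open>s\<close> are
  arbitrary and independent.\<close>

lemma associated_costates_stationarity:
  fixes x p1 p2 :: "real \<Rightarrow> real^'n"
  assumes t: "t0 < \<tau>" "\<tau> < tf" and bc: "x t0 = x0" "x tf = xf"
    and f1: "C1_on (\<lambda>(y, v, t). f1 y v t) UNIV" and f2: "C1_on (\<lambda>(y, v, t). f2 y v t) UNIV"
    and L1: "C1_on (\<lambda>(y, v, t). L1 y v t) UNIV" and L2: "C1_on (\<lambda>(y, v, t). L2 y v t) UNIV"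
    and costates: "associated_costates f1 f2 L1 L2 \<phi> g t0 tf x0 xf x v1 v2 \<tau> p1 p2"
    and g: "GDERIV g (x \<tau>) :> m"
  obtains \<nu> where "\<And>s v. (\<nu> *\<^sub>R m + p2 \<tau> - p1 \<tau>) \<bullet> v +
      (hamiltonian L1 f1 (x \<tau>) (p1 \<tau>) (v1 \<tau>) \<tau> - hamiltonian L2 f2 (x \<tau>) (p2 \<tau>) (v2 \<tau>) \<tau>) * s = 0"
proof -
  from costates obtain \<eta> x1 x2 u1 u2 l1 l2 \<nu> where "\<eta> > 0" and
    reg: "C1_on x1 {t0..\<tau> + \<eta>}" "C1_on x2 {\<tau> - \<eta>..tf}"
        "continuous_on {t0..\<tau> + \<eta>} u1" "continuous_on {\<tau> - \<eta>..tf} u2"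
        "C1_on l1 {t0..\<tau> + \<eta>}" "C1_on l2 {\<tau> - \<eta>..tf}" and
    ext: "\<forall>t\<in>{t0..\<tau>}. x1 t = x t \<and> u1 t = v1 t \<and> l1 t = p1 t"
        "\<forall>t\<in>{\<tau>..tf}. x2 t = x t \<and> u2 t = v2 t \<and> l2 t = p2 t" and
    stat: "\<forall>\<delta>>0. \<forall>X1 X2 U1 U2 T.
           variation t0 tf x0 xf \<eta> x1 x2 u1 u2 \<tau> \<delta> X1 X2 U1 U2 T \<longrightarrow>
           ((\<lambda>\<epsilon>. augmented_cost f1 f2 L1 L2 \<phi> g t0 tf l1 l2 \<nu> (X1 \<epsilon>) (X2 \<epsilon>) (U1 \<epsilon>) (U2 \<epsilon>) (T \<epsilon>))
              has_real_derivative 0) (at 0)"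
    unfolding associated_costates_def by blast
  have \<tau>: "x1 \<tau> = x \<tau>" "x2 \<tau> = x \<tau>" "u1 \<tau> = v1 \<tau>" "u2 \<tau> = v2 \<tau>" "l1 \<tau> = p1 \<tau>" "l2 \<tau> = p2 \<tau>"
    "x1 t0 = x0" "x2 tf = xf"
    using ext t bc by auto
  define H1 where "H1 = hamiltonian L1 f1 (x \<tau>) (p1 \<tau>) (v1 \<tau>) \<tau>"
  define H2 where "H2 = hamiltonian L2 f2 (x \<tau>) (p2 \<tau>) (v2 \<tau>) \<tau>"
  have "(\<nu> *\<^sub>R m + p2 \<tau> - p1 \<tau>) \<bullet> v + (H1 - H2) * s = 0" for s v
  proof -
    \<comment> \<open>The crossing time has to stay between \<open>t0\<close> and \<open>tf\<close> and within the margin \<open>\<eta>\<close> of the extensions.\<close>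
    define r where "r = Min {\<eta>, \<tau> - t0, tf - \<tau>}"
    have r: "r > 0" "r \<le> \<eta>" "r \<le> \<tau> - t0" "r \<le> tf - \<tau>"
      using t \<open>\<eta> > 0\<close> by (auto simp: r_def)
    \<comment> \<open>The summand 1 covers \<open>s = 0\<close>.\<close>
    define \<delta> where "\<delta> = r / (\<bar>s\<bar> + 1)"
    have \<delta>: "\<delta> > 0" using r by (simp add: \<delta>_def)
    have s\<epsilon>: "\<bar>s * \<epsilon>\<bar> < r" if "\<bar>\<epsilon>\<bar> < \<delta>" for \<epsilon>
    proof -
      have "\<bar>s * \<epsilon>\<bar> \<le> (\<bar>s\<bar> + 1) * \<bar>\<epsilon>\<bar>" by (auto simp: abs_mult intro: mult_right_mono)
      also have "\<dots> < r" using that by (simp add: \<delta>_def field_simps)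
      finally show ?thesis .
    qed
    define E where "E = (\<nu> *\<^sub>R m + p2 \<tau> - p1 \<tau>) \<bullet> v + (H1 - H2) * s"
    have "\<bar>E\<bar> \<le> 2 * \<kappa>" if \<kappa>: "\<kappa> > 0" for \<kappa>
    proof -
      have "\<And>\<epsilon>. \<bar>\<epsilon>\<bar> < \<delta> \<Longrightarrow> \<bar>s * \<epsilon>\<bar> < min (\<tau> - t0) (\<tau> + \<eta> - \<tau>)"
        "\<And>\<epsilon>. \<bar>\<epsilon>\<bar> < \<delta> \<Longrightarrow> \<bar>s * \<epsilon>\<bar> < min (\<tau> - (\<tau> - \<eta>)) (tf - \<tau>)"
        using s\<epsilon> r by fastforce+
      note s1 = this(1) and s2 = this(2)
      obtain X1 D1 where X1: "C1_family_C1 {-\<delta><..<\<delta>} {t0..\<tau> + \<eta>} X1" "X1 0 = x1"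
        "\<And>\<epsilon>. X1 \<epsilon> t0 = x0" "\<And>\<epsilon>. \<epsilon> \<in> {-\<delta><..<\<delta>} \<Longrightarrow> X1 \<epsilon> (\<tau> + s * \<epsilon>) = x \<tau> + \<epsilon> *\<^sub>R v"
        "((\<lambda>\<epsilon>. phase_cost L1 f1 l1 u1 t0 (\<tau> + s * \<epsilon>) (X1 \<epsilon>)) has_real_derivative
           H1 * s - p1 \<tau> \<bullet> v + D1) (at 0)" "\<bar>D1\<bar> < \<kappa>"
      proof (rule phase_variation[OF L1 f1 reg(1,5,3) _ _ \<delta> s1 _ \<kappa>, where p = t0 and v = v])
        fix X D
        assume "C1_family_C1 {-\<delta><..<\<delta>} {t0..\<tau> + \<eta>} X" "X 0 = x1" "\<And>\<epsilon>. X \<epsilon> t0 = x1 t0"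
          "\<And>\<epsilon>. \<epsilon> \<in> {-\<delta><..<\<delta>} \<Longrightarrow> X \<epsilon> (\<tau> + s * \<epsilon>) = x1 \<tau> + \<epsilon> *\<^sub>R v"
          "t0 = t0 \<Longrightarrow> ((\<lambda>\<epsilon>. phase_cost L1 f1 l1 u1 t0 (\<tau> + s * \<epsilon>) (X \<epsilon>)) has_real_derivative
             hamiltonian L1 f1 (x1 \<tau>) (l1 \<tau>) (u1 \<tau>) \<tau> * s - l1 \<tau> \<bullet> v + D) (at 0)" "\<bar>D\<bar> < \<kappa>"
        then show ?thesis by (intro that[of X D]) (simp_all add: \<tau> H1_def)
      qed (use t \<open>\<eta> > 0\<close> in auto)
      obtain X2 D2 where X2: "C1_family_C1 {-\<delta><..<\<delta>} {\<tau> - \<eta>..tf} X2" "X2 0 = x2"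
        "\<And>\<epsilon>. X2 \<epsilon> tf = xf" "\<And>\<epsilon>. \<epsilon> \<in> {-\<delta><..<\<delta>} \<Longrightarrow> X2 \<epsilon> (\<tau> + s * \<epsilon>) = x \<tau> + \<epsilon> *\<^sub>R v"
        "((\<lambda>\<epsilon>. phase_cost L2 f2 l2 u2 (\<tau> + s * \<epsilon>) tf (X2 \<epsilon>)) has_real_derivative
           p2 \<tau> \<bullet> v - H2 * s + D2) (at 0)" "\<bar>D2\<bar> < \<kappa>"
      proof (rule phase_variation[OF L2 f2 reg(2,6,4) _ _ \<delta> s2 _ \<kappa>, where p = tf and v = v])
        fix X D
        assume "C1_family_C1 {-\<delta><..<\<delta>} {\<tau> - \<eta>..tf} X" "X 0 = x2" "\<And>\<epsilon>. X \<epsilon> tf = x2 tf"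
          "\<And>\<epsilon>. \<epsilon> \<in> {-\<delta><..<\<delta>} \<Longrightarrow> X \<epsilon> (\<tau> + s * \<epsilon>) = x2 \<tau> + \<epsilon> *\<^sub>R v"
          "tf = tf \<Longrightarrow> ((\<lambda>\<epsilon>. phase_cost L2 f2 l2 u2 (\<tau> + s * \<epsilon>) tf (X \<epsilon>)) has_real_derivative
             l2 \<tau> \<bullet> v - hamiltonian L2 f2 (x2 \<tau>) (l2 \<tau>) (u2 \<tau>) \<tau> * s + D) (at 0)" "\<bar>D\<bar> < \<kappa>"
        then show ?thesis by (intro that[of X D]) (simp_all add: \<tau> H2_def)
      qed (use t \<open>\<eta> > 0\<close> in auto)
      have const: "C1_family_C0 I S (\<lambda>\<epsilon>. w)" if "continuous_on S w" for I S and w :: "real \<Rightarrow> real^'m"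
        using C1_family_C0_affine[of S w "\<lambda>_. 0" I "\<lambda>_. 0" "\<lambda>_. 0"] that by simp
      have "variation t0 tf x0 xf \<eta> x1 x2 u1 u2 \<tau> \<delta> X1 X2 (\<lambda>_. u1) (\<lambda>_. u2) (\<lambda>\<epsilon>. \<tau> + s * \<epsilon>)"
        unfolding variation_def
      proof (intro conjI ballI)
        show "C1_on (\<lambda>\<epsilon>. \<tau> + s * \<epsilon>) {-\<delta><..<\<delta>}"
          unfolding C1_on_def
          by (intro exI[of _ "\<lambda>_. blinfun_mult_right s"]) (auto intro!: derivative_eq_intros)
        show "\<tau> + s * \<epsilon> \<in> {\<tau> - \<eta>..\<tau> + \<eta>}" if "\<epsilon> \<in> {-\<delta><..<\<delta>}" for \<epsilon>
        proof -
          have "\<bar>s * \<epsilon>\<bar> < r" using that by (intro s\<epsilon>) auto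
          with r show ?thesis by auto
        qed
      qed (use X1 X2 const reg in auto)
      with stat \<delta> have zero: "((\<lambda>\<epsilon>. augmented_cost f1 f2 L1 L2 \<phi> g t0 tf l1 l2 \<nu> (X1 \<epsilon>) (X2 \<epsilon>) u1 u2 (\<tau> + s * \<epsilon>))
          has_real_derivative 0) (at 0)"
        by blast
      have "\<forall>\<^sub>F \<epsilon> in nhds 0. \<epsilon> \<in> {-\<delta><..<\<delta>}"
        using \<delta> eventually_nhds_in_open[of "{-\<delta><..<\<delta>}" 0] by auto
      then have "\<forall>\<^sub>F \<epsilon> in nhds 0. augmented_cost f1 f2 L1 L2 \<phi> g t0 tf l1 l2 \<nu> (X1 \<epsilon>) (X2 \<epsilon>) u1 u2 (\<tau> + s * \<epsilon>) =
          \<phi> xf + \<nu> * g (x \<tau> + \<epsilon> *\<^sub>R v) + phase_cost L1 f1 l1 u1 t0 (\<tau> + s * \<epsilon>) (X1 \<epsilon>)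
             + phase_cost L2 f2 l2 u2 (\<tau> + s * \<epsilon>) tf (X2 \<epsilon>)"
        by eventually_elim (simp add: augmented_cost_def phase_cost_def X1(4) X2(3))
      with zero have "((\<lambda>\<epsilon>. \<phi> xf + \<nu> * g (x \<tau> + \<epsilon> *\<^sub>R v) + phase_cost L1 f1 l1 u1 t0 (\<tau> + s * \<epsilon>) (X1 \<epsilon>)
             + phase_cost L2 f2 l2 u2 (\<tau> + s * \<epsilon>) tf (X2 \<epsilon>)) has_real_derivative 0) (at 0)"
        by (simp add: DERIV_cong_ev[OF refl _ refl])
      moreover have "((\<lambda>\<epsilon>. g (x \<tau> + \<epsilon> *\<^sub>R v)) has_real_derivative m \<bullet> v) (at 0)"
      proof -
        have "((\<lambda>\<epsilon>. x \<tau> + \<epsilon> *\<^sub>R v) has_derivative (\<lambda>h. h *\<^sub>R v)) (at 0)"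
          by (auto intro!: derivative_eq_intros)
        moreover have "(g has_derivative (\<lambda>h. h \<bullet> m)) (at (x \<tau> + 0 *\<^sub>R v))"
          using g by (simp add: gderiv_def)
        ultimately have "((\<lambda>\<epsilon>. g (x \<tau> + \<epsilon> *\<^sub>R v)) has_derivative (\<lambda>h. (h *\<^sub>R v) \<bullet> m)) (at 0)"
          by (rule has_derivative_compose)
        then show ?thesis
          unfolding has_field_derivative_def
          by (rule has_derivative_eq_rhs) (auto simp: inner_commute)
      qed
      then have "((\<lambda>\<epsilon>. \<phi> xf + \<nu> * g (x \<tau> + \<epsilon> *\<^sub>R v) + phase_cost L1 f1 l1 u1 t0 (\<tau> + s * \<epsilon>) (X1 \<epsilon>)
             + phase_cost L2 f2 l2 u2 (\<tau> + s * \<epsilon>) tf (X2 \<epsilon>)) has_real_derivative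
             0 + \<nu> * (m \<bullet> v) + (H1 * s - p1 \<tau> \<bullet> v + D1) + (p2 \<tau> \<bullet> v - H2 * s + D2)) (at 0)"
        by (intro DERIV_add DERIV_const DERIV_cmult X1(5) X2(5))
      ultimately have "0 + \<nu> * (m \<bullet> v) + (H1 * s - p1 \<tau> \<bullet> v + D1) + (p2 \<tau> \<bullet> v - H2 * s + D2) = 0"
        using DERIV_unique by blast
      then have "E + (D1 + D2) = 0" by (simp add: E_def algebra_simps)
      then show ?thesis using X1(6) X2(6) by linarith
    qed
    then have "\<bar>E\<bar> \<le> 0 + e" if "e > 0" for e
      using that by (metis half_gt_zero field_sum_of_halves mult_2 add_0)
    then have "\<bar>E\<bar> \<le> 0" by (rule field_le_epsilon)
    then show ?thesis by (simp add: E_def)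
  qed
  then show ?thesis using that unfolding H1_def H2_def by blast
qed

theorem mainTheorem1:
  fixes f1 f2 :: "real^'n \<Rightarrow> real^'m \<Rightarrow> real \<Rightarrow> real^'n"
    and L1 L2 :: "real^'n \<Rightarrow> real^'m \<Rightarrow> real \<Rightarrow> real"
    and \<phi> g :: "real^'n \<Rightarrow> real"
    and t0 tf \<tau> :: real
    and x0 xf m :: "real^'n"
    and x p1 p2 :: "real \<Rightarrow> real^'n"
    and u u1 u2 :: "real \<Rightarrow> real^'m"
  assumes "t0 < tf" and "g x0 < 0" and "g xf > 0"
    and "C1_on (\<lambda>(y, v, t). f1 y v t) UNIV" and "C1_on (\<lambda>(y, v, t). f2 y v t) UNIV"
    and "C1_on (\<lambda>(y, v, t). L1 y v t) UNIV" and "C1_on (\<lambda>(y, v, t). L2 y v t) UNIV"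
    and "C1_on \<phi> UNIV" and "C1_on g UNIV"
    and "optimal f1 f2 L1 L2 \<phi> g t0 tf x0 xf x u \<tau>"
    and "phase_controls t0 tf \<tau> u u1 u2"
    and "associated_costates f1 f2 L1 L2 \<phi> g t0 tf x0 xf x u1 u2 \<tau> p1 p2"
    and "GDERIV g (x \<tau>) :> m"
  shows "let f1\<tau> = f1 (x \<tau>) (u1 \<tau>) \<tau>; f2\<tau> = f2 (x \<tau>) (u2 \<tau>) \<tau>;
             \<Delta>p = p2 \<tau> - p1 \<tau>; avgp = (1/2) *\<^sub>R (p2 \<tau> + p1 \<tau>);
             \<Delta>f = f2\<tau> - f1\<tau>; avgf = (1/2) *\<^sub>R (f2\<tau> + f1\<tau>);
             \<Delta>L = L2 (x \<tau>) (u2 \<tau>) \<tau> - L1 (x \<tau>) (u1 \<tau>) \<tau>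
         in m \<bullet> avgf \<noteq> 0 \<longrightarrow>
            \<Delta>p = - (((\<Delta>L + avgp \<bullet> \<Delta>f) / (m \<bullet> avgf)) *\<^sub>R m)"
proof -
  have adm: "t0 < \<tau>" "\<tau> < tf" "x t0 = x0" "x tf = xf"
    using \<open>optimal f1 f2 L1 L2 \<phi> g t0 tf x0 xf x u \<tau>\<close> by (auto simp: optimal_def admissible_def)
  obtain \<nu> where stationary: "\<And>s v. (\<nu> *\<^sub>R m + p2 \<tau> - p1 \<tau>) \<bullet> v +
      (hamiltonian L1 f1 (x \<tau>) (p1 \<tau>) (u1 \<tau>) \<tau> - hamiltonian L2 f2 (x \<tau>) (p2 \<tau>) (u2 \<tau>) \<tau>) * s = 0"
    using associated_costates_stationarity[OF adm assms(4-7,12,13)] by blast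
  define F1 F2 where "F1 = f1 (x \<tau>) (u1 \<tau>) \<tau>" and "F2 = f2 (x \<tau>) (u2 \<tau>) \<tau>"
  define \<Delta>L where "\<Delta>L = L2 (x \<tau>) (u2 \<tau>) \<tau> - L1 (x \<tau>) (u1 \<tau>) \<tau>"
  define avgp where "avgp = (1/2) *\<^sub>R (p2 \<tau> + p1 \<tau>)"
  define avgf where "avgf = (1/2) *\<^sub>R (F2 + F1)"
  have "(\<nu> *\<^sub>R m + p2 \<tau> - p1 \<tau>) \<bullet> v = 0" for v
    using stationary[of v 0] by simp
  from this[of "\<nu> *\<^sub>R m + p2 \<tau> - p1 \<tau>"] have "\<nu> *\<^sub>R m + p2 \<tau> - p1 \<tau> = 0"
    by simp
  then have jump: "p2 \<tau> - p1 \<tau> = - (\<nu> *\<^sub>R m)"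
    by (metis add_diff_eq eq_neg_iff_add_eq_0 add.commute)
  have "\<Delta>L + p2 \<tau> \<bullet> F2 - p1 \<tau> \<bullet> F1 = 0"
    using stationary[of 0 1] by (simp add: hamiltonian_def \<Delta>L_def F1_def F2_def)
  moreover have "p2 \<tau> \<bullet> F2 - p1 \<tau> \<bullet> F1 = avgp \<bullet> (F2 - F1) + (p2 \<tau> - p1 \<tau>) \<bullet> avgf"
    by (simp add: avgp_def avgf_def inner_add_left inner_add_right inner_diff_left inner_diff_right field_simps)
  ultimately have "\<Delta>L + avgp \<bullet> (F2 - F1) = \<nu> * (m \<bullet> avgf)"
    by (simp add: jump)
  then have "p2 \<tau> - p1 \<tau> = - (((\<Delta>L + avgp \<bullet> (F2 - F1)) / (m \<bullet> avgf)) *\<^sub>R m)" if "m \<bullet> avgf \<noteq> 0"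
    using that by (simp add: jump)
  then show ?thesis
    unfolding Let_def F1_def F2_def \<Delta>L_def avgp_def avgf_def by blast
qed

end
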